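(* Let $q\in[-1,1]$, let $d\ge1$, and let $(c(i,j))_{i,j=1}^d$ be a real positive definite matrix. Let $(\mathcal{A},\phi)$ be a probability space with expectation $\mathbb{E}$, with $\mathcal{A}$ generated by symmetric operators $X_1,\ldots,X_d$, such that for all $i,j\in\{1,\ldots,d\}$ \[ [a^-(i);a^+(j)]_q=c(i,j)\, I,\qquad [a^-(i);a^0(j)]_q=0,\qquad \mathbb{E}[X_i]=0, \] where $a^-(i),a^0(i),a^+(i)$ are the annihilation, preservation and creation operators of $X_i$. Then for every $k\in\mathbb{N}$ and all $\sigma(1),\ldots,\sigma(k)\in\{1,\ldots,d\}$, \[ \mathbb{E}[X_{\sigma(1)}\cdots X_{\sigma(k)}]=\begin{cases}0 & \text{if } k \text{ is odd},\\[2pt] \displaystyle\sum_{\gamma\in \mathsf{F}_c(\{1,\ldots,2n\})} q^{c(\gamma)}\,\nu(\gamma) & \text{if } k=2n,\end{cases} \] where $\mathsf{F}_c(\{1,\ldots,2n\})$ is the set of complete Feynman diagrams on $\{1,\ldots,2n\}$, $c(\gamma)$ is the crossing number of $\gamma$, and $\nu(\gamma)=\prod_{(i,j)\in\gamma}c(\sigma(i),\sigma(j))$.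
   Context: **Probability spaces.** Let $(H,\langle\cdot,\cdot\rangle)$ be a real Hilbert space and $X_1,\ldots,X_d$ symmetric, densely defined linear operators on $H$. $\mathcal{A}$ is the unital algebra generated by $X_1,\ldots,X_d$ (containing the identity $I$). A unit vector $\phi\in H$ (the vacuum vector) lying in the domain of every $g\in\mathcal{A}$ is fixed. $(\mathcal{A},\phi)$ is called a probability space supported by $H$ and $\mathbb{E}[g]:=\langle g\phi,\phi\rangle$ for $g\in\mathcal{A}$. **Annihilation, preservation, creation operators.** For $n\ge 0$ let $F_n=\{p(X_1,\ldots,X_d)\phi: p \text{ a noncommutative polynomial of total degree}\le n\}$. Put $G_{-1}=\{0\}$, $G_0=F_0$, and for $n\ge1$ let $G_n$ be the orthogonal complement of $F_{n-1}$ in $F_n$. Then $\mathcal{A}\phi=\{g\phi:g\in\mathcal{A}\}$ is the algebraic direct sum of the $G_n$ and $X_iG_n\subset G_{n-1}\oplus G_n\oplus G_{n+1}$; $a^-(i),a^0(i),a^+(i)$ are the unique linear operators with domain $\mathcal{A}\phi$ with $X_i=a^-(i)+a^0(i)+a^+(i)$ on $\mathcal{A}\phi$, $a^-(i)(G_n)\subset G_{n-1}$, $a^0(i)(G_n)\subset G_n$, $a^+(i)(G_n)\subset G_{n+1}$ for all $n\ge0$. Operator identities are on $\mathcal{A}\phi$. **$q$-commutator.** $[A;B]_q:=AB-q\,BA$. Convention: $0^0=1$. **Feynman diagrams.** For a finite linearly ordered set $S$ with an even number of elements, a complete Feynman diagram on $S$ is a partition $\gamma$ of $S$ into two-element sets,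 regarded as a set of ordered pairs $(i,j)$ with $i<j$; $\mathsf{F}_c(S)$ is the set of these. A pair $(k,l)\in\gamma$ is a left crossing for $(i,j)\in\gamma$ if $k<i<l<j$; $c_l(i,j)$ is the number of left crossings for $(i,j)$, and $c(\gamma)=\sum_{(i,j)\in\gamma}c_l(i,j)$ is the crossing number. *)

theory Defs
  imports "HOL-Analysis.Analysis" "HOL-Library.Poly_Mapping" "HOL-Library.Disjoint_Sets"
begin

text \<open>Unbounded operators are partial functions: the domain of an operator \<open>T\<close> is \<open>dom T\<close>,
  equality of operators includes equality of domains, and \<open>T \<circ>\<^sub>m S\<close> is the operator product
  with its natural domain \<open>{x \<in> dom S. S x \<in> dom T}\<close>.\<close>

type_synonym 'h operator = "'h \<Rightarrow> 'h option"

definition linear_operator :: "('h::real_vector) operator \<Rightarrow> bool" where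
  "linear_operator T \<longleftrightarrow> subspace (dom T) \<and>
     (\<forall>x\<in>dom T. \<forall>y\<in>dom T. the (T (x + y)) = the (T x) + the (T y)) \<and>
     (\<forall>x\<in>dom T. \<forall>r. the (T (r *\<^sub>R x)) = r *\<^sub>R the (T x))"

definition densely_defined :: "('h::topological_space) operator \<Rightarrow> bool" where
  "densely_defined T \<longleftrightarrow> closure (dom T) = UNIV"

definition symmetric_operator :: "('h::real_inner) operator \<Rightarrow> bool" where
  "symmetric_operator T \<longleftrightarrow> (\<forall>x\<in>dom T. \<forall>y\<in>dom T. the (T x) \<bullet> y = x \<bullet> the (T y))"

abbreviation op_id :: "'h operator" where
  "op_id \<equiv> Some"

definition op_add :: "('h::real_vector) operator \<Rightarrow> 'h operator \<Rightarrow> 'h operator" where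
  "op_add S T = (\<lambda>x. if x \<in> dom S \<and> x \<in> dom T then Some (the (S x) + the (T x)) else None)"

definition op_scale :: "real \<Rightarrow> ('h::real_vector) operator \<Rightarrow> 'h operator" where
  "op_scale r T = (\<lambda>x. map_option (\<lambda>y. r *\<^sub>R y) (T x))"

definition q_commutator :: "real \<Rightarrow> ('h::real_vector) operator \<Rightarrow> 'h operator \<Rightarrow> 'h operator" where
  "q_commutator q A B = op_add (A \<circ>\<^sub>m B) (op_scale (- q) (B \<circ>\<^sub>m A))"

inductive_set generated_algebra :: "('h::real_vector) operator set \<Rightarrow> 'h operator set"
  for S :: "'h operator set" where
  one: "op_id \<in> generated_algebra S"
| generator: "T \<in> S \<Longrightarrow> T \<in> generated_algebra S"
| add: "A \<in> generated_algebra S \<Longrightarrow> B \<in> generated_algebra S \<Longrightarrow> op_add A B \<in> generated_algebra S"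
| scale: "A \<in> generated_algebra S \<Longrightarrow> op_scale r A \<in> generated_algebra S"
| mult: "A \<in> generated_algebra S \<Longrightarrow> B \<in> generated_algebra S \<Longrightarrow> A \<circ>\<^sub>m B \<in> generated_algebra S"

definition prob_algebra :: "nat \<Rightarrow> (nat \<Rightarrow> ('h::real_vector) operator) \<Rightarrow> 'h operator set" where
  "prob_algebra d X = generated_algebra (X ` {1..d})"

definition noncomm_prob_space ::
  "nat \<Rightarrow> (nat \<Rightarrow> ('h::{real_inner, complete_space}) operator) \<Rightarrow> 'h \<Rightarrow> bool" where
  "noncomm_prob_space d X \<phi> \<longleftrightarrow>
     (\<forall>i\<in>{1..d}. linear_operator (X i) \<and> densely_defined (X i) \<and> symmetric_operator (X i)) \<and>
     norm \<phi> = 1 \<and> (\<forall>g\<in>prob_algebra d X. \<phi> \<in> dom g)"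

definition expectation :: "('h::real_inner) \<Rightarrow> 'h operator \<Rightarrow> real" where
  "expectation \<phi> g = the (g \<phi>) \<bullet> \<phi>"

definition op_word :: "(nat \<Rightarrow> 'h operator) \<Rightarrow> nat list \<Rightarrow> 'h operator" where
  "op_word X w = foldr (\<lambda>i T. X i \<circ>\<^sub>m T) w op_id"

text \<open>A noncommutative polynomial in the variables \<open>1, \<dots>, d\<close> is a finitely supported
  family of coefficients indexed by the words over \<open>{1..d}\<close>.\<close>

definition nc_polys :: "nat \<Rightarrow> nat \<Rightarrow> (nat list \<Rightarrow>\<^sub>0 real) set" where
  "nc_polys d n = {p. \<forall>w\<in>Poly_Mapping.keys p. set w \<subseteq> {1..d} \<and> length w \<le> n}"

definition nc_eval :: "(nat \<Rightarrow> ('h::real_vector) operator) \<Rightarrow> (nat list \<Rightarrow>\<^sub>0 real) \<Rightarrow> 'h operator" where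
  "nc_eval X p = (\<lambda>x. if \<forall>w\<in>Poly_Mapping.keys p. x \<in> dom (op_word X w)
     then Some (\<Sum>w\<in>Poly_Mapping.keys p. Poly_Mapping.lookup p w *\<^sub>R the (op_word X w x)) else None)"

definition F_space :: "nat \<Rightarrow> (nat \<Rightarrow> ('h::real_vector) operator) \<Rightarrow> 'h \<Rightarrow> nat \<Rightarrow> 'h set" where
  "F_space d X \<phi> n = {the (nc_eval X p \<phi>) | p. p \<in> nc_polys d n}"

definition G_space :: "nat \<Rightarrow> (nat \<Rightarrow> ('h::real_inner) operator) \<Rightarrow> 'h \<Rightarrow> int \<Rightarrow> 'h set" where
  "G_space d X \<phi> n =
     (if n < 0 then {0}
      else if n = 0 then F_space d X \<phi> 0
      else {v \<in> F_space d X \<phi> (nat n). \<forall>u\<in>F_space d X \<phi> (nat (n - 1)). orthogonal v u})"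

definition vacuum_domain :: "nat \<Rightarrow> (nat \<Rightarrow> ('h::real_vector) operator) \<Rightarrow> 'h \<Rightarrow> 'h set" where
  "vacuum_domain d X \<phi> = {the (g \<phi>) | g. g \<in> prob_algebra d X}"

definition apc_decomposition ::
  "nat \<Rightarrow> (nat \<Rightarrow> ('h::real_inner) operator) \<Rightarrow> 'h \<Rightarrow> nat \<Rightarrow>
   'h operator \<times> 'h operator \<times> 'h operator \<Rightarrow> bool" where
  "apc_decomposition d X \<phi> i = (\<lambda>(am, a0, ap).
     (\<forall>T\<in>{am, a0, ap}. linear_operator T \<and> dom T = vacuum_domain d X \<phi>) \<and>
     X i |` vacuum_domain d X \<phi> = op_add am (op_add a0 ap) \<and>
     (\<forall>n\<ge>0. \<forall>v\<in>G_space d X \<phi> n.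
        the (am v) \<in> G_space d X \<phi> (n - 1) \<and>
        the (a0 v) \<in> G_space d X \<phi> n \<and>
        the (ap v) \<in> G_space d X \<phi> (n + 1)))"

text \<open>Existence and uniqueness of the decomposition is \<open>apc_decomposition_ex1\<close> below.\<close>

definition apc_operators ::
  "nat \<Rightarrow> (nat \<Rightarrow> ('h::real_inner) operator) \<Rightarrow> 'h \<Rightarrow> nat \<Rightarrow>
   'h operator \<times> 'h operator \<times> 'h operator" where
  "apc_operators d X \<phi> i = (THE t. apc_decomposition d X \<phi> i t)"

definition annihilation :: "nat \<Rightarrow> (nat \<Rightarrow> ('h::real_inner) operator) \<Rightarrow> 'h \<Rightarrow> nat \<Rightarrow> 'h operator" where
  "annihilation d X \<phi> i = fst (apc_operators d X \<phi> i)"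

definition preservation :: "nat \<Rightarrow> (nat \<Rightarrow> ('h::real_inner) operator) \<Rightarrow> 'h \<Rightarrow> nat \<Rightarrow> 'h operator" where
  "preservation d X \<phi> i = fst (snd (apc_operators d X \<phi> i))"

definition creation :: "nat \<Rightarrow> (nat \<Rightarrow> ('h::real_inner) operator) \<Rightarrow> 'h \<Rightarrow> nat \<Rightarrow> 'h operator" where
  "creation d X \<phi> i = snd (snd (apc_operators d X \<phi> i))"

definition positive_definite :: "nat \<Rightarrow> (nat \<Rightarrow> nat \<Rightarrow> real) \<Rightarrow> bool" where
  "positive_definite d c \<longleftrightarrow>
     (\<forall>i\<in>{1..d}. \<forall>j\<in>{1..d}. c i j = c j i) \<and>
     (\<forall>x. (\<exists>i\<in>{1..d}. x i \<noteq> 0) \<longrightarrow> (\<Sum>i\<in>{1..d}. \<Sum>j\<in>{1..d}. c i j * x i * x j) > 0)"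

definition complete_feynman :: "'a::linorder set \<Rightarrow> ('a \<times> 'a) set set" where
  "complete_feynman S =
     (\<lambda>P. {(i, j). i < j \<and> {i, j} \<in> P}) ` {P. partition_on S P \<and> (\<forall>B\<in>P. card B = 2)}"

definition left_crossings :: "('a::linorder \<times> 'a) set \<Rightarrow> 'a \<times> 'a \<Rightarrow> nat" where
  "left_crossings \<gamma> = (\<lambda>(i, j). card {(k, l) \<in> \<gamma>. k < i \<and> i < l \<and> l < j})"

definition crossing_number :: "('a::linorder \<times> 'a) set \<Rightarrow> nat" where
  "crossing_number \<gamma> = (\<Sum>e\<in>\<gamma>. left_crossings \<gamma> e)"

definition diagram_weight :: "(nat \<Rightarrow> nat \<Rightarrow> real) \<Rightarrow> ('a \<Rightarrow> nat) \<Rightarrow> ('a \<times> 'a) set \<Rightarrow> real" where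
  "diagram_weight c \<sigma> \<gamma> = (\<Prod>(i, j)\<in>\<gamma>. c (\<sigma> i) (\<sigma> j))"

lemma op_word_simps: "op_word X [] = op_id" "op_word X (i # w) = X i \<circ>\<^sub>m op_word X w"
  by (simp_all add: op_word_def)

lemma op_word_in_algebra: "set w \<subseteq> {1..d} \<Longrightarrow> op_word X w \<in> prob_algebra d X"
proof (induction w)
  case Nil
  show ?case by (simp add: op_word_simps prob_algebra_def generated_algebra.one)
next
  case (Cons i w)
  then have "X i \<in> generated_algebra (X ` {1..d})" by (intro generated_algebra.generator) auto
  with Cons show ?case by (simp add: op_word_simps prob_algebra_def generated_algebra.mult)
qed

lemma linear_operator_zero:
  assumes L: "linear_operator T"
  shows "0 \<in> dom T" "the (T 0) = 0"
proof -
  show 0: "0 \<in> dom T" using L subspace_0 unfolding linear_operator_def by metis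
  with L have "the (T (0 *\<^sub>R 0)) = 0 *\<^sub>R the (T 0)" unfolding linear_operator_def by blast
  then show "the (T 0) = 0" by simp
qed

lemma F_space_eq_span:
  assumes "noncomm_prob_space d X \<phi>"
  shows "F_space d X \<phi> n =
    span ((\<lambda>w. the (op_word X w \<phi>)) ` {w. set w \<subseteq> {1..d} \<and> length w \<le> n})"
    (is "_ = span (?f ` ?W)")
proof -
  have dom: "\<phi> \<in> dom (op_word X w)" if "set w \<subseteq> {1..d}" for w
    using assms op_word_in_algebra[OF that] unfolding noncomm_prob_space_def by blast
  have ev: "the (nc_eval X p \<phi>) =
      (\<Sum>w\<in>Poly_Mapping.keys p. Poly_Mapping.lookup p w *\<^sub>R ?f w)"
    if "p \<in> nc_polys d n" for p
  proof -
    have "\<forall>w\<in>Poly_Mapping.keys p. \<phi> \<in> dom (op_word X w)"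
      using that dom by (auto simp: nc_polys_def)
    then show ?thesis unfolding nc_eval_def by simp
  qed
  show ?thesis
  proof
    show "F_space d X \<phi> n \<subseteq> span (?f ` ?W)"
      unfolding F_space_def
      by (auto simp: ev) (auto simp: nc_polys_def intro!: span_sum span_scale intro: span_base)
    show "span (?f ` ?W) \<subseteq> F_space d X \<phi> n"
    proof
      fix v assume "v \<in> span (?f ` ?W)"
      then show "v \<in> F_space d X \<phi> n"
      proof (induction rule: span_induct_alt)
        case base
        have "0 \<in> nc_polys d n" by (simp add: nc_polys_def)
        then show ?case unfolding F_space_def using ev[of 0] by force
      next
        case (step c x y)
        then obtain w p where w: "w \<in> ?W" "x = ?f w"
          and p: "p \<in> nc_polys d n" "y = the (nc_eval X p \<phi>)"
          by (auto simp: F_space_def)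
        define p' where "p' = Poly_Mapping.single w c + p"
        have sub: "Poly_Mapping.keys p' \<subseteq> insert w (Poly_Mapping.keys p)"
          unfolding p'_def using Poly_Mapping.keys_add[of "Poly_Mapping.single w c" p]
          by (auto split: if_splits)
        have p': "p' \<in> nc_polys d n" using sub w p unfolding nc_polys_def by auto
        have "the (nc_eval X p' \<phi>) =
            (\<Sum>u\<in>insert w (Poly_Mapping.keys p). Poly_Mapping.lookup p' u *\<^sub>R ?f u)"
          unfolding ev[OF p'] by (rule sum.mono_neutral_left) (use sub in \<open>auto simp: in_keys_iff\<close>)
        also have "\<dots> = (\<Sum>u\<in>insert w (Poly_Mapping.keys p).
            (c when w = u) *\<^sub>R ?f u + Poly_Mapping.lookup p u *\<^sub>R ?f u)"
          by (simp add: p'_def lookup_add lookup_single scaleR_add_left)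
        also have "\<dots> = (\<Sum>u\<in>insert w (Poly_Mapping.keys p). (c when w = u) *\<^sub>R ?f u) +
            (\<Sum>u\<in>insert w (Poly_Mapping.keys p). Poly_Mapping.lookup p u *\<^sub>R ?f u)"
          by (rule sum.distrib)
        also have "(\<Sum>u\<in>insert w (Poly_Mapping.keys p). (c when w = u) *\<^sub>R ?f u) =
            (\<Sum>u\<in>insert w (Poly_Mapping.keys p). if w = u then c *\<^sub>R ?f u else 0)"
          by (rule sum.cong) (auto simp: when_def)
        also have "\<dots> = c *\<^sub>R x" using w by simp
        also have "(\<Sum>u\<in>insert w (Poly_Mapping.keys p). Poly_Mapping.lookup p u *\<^sub>R ?f u) = y"
          unfolding p(2) ev[OF p(1)]
          by (rule sum.mono_neutral_right) (auto simp: in_keys_iff)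
        finally show ?case using p' by (auto simp: F_space_def intro!: exI[of _ p'])
      qed
    qed
  qed
qed

lemma finite_span_projection:
  fixes B :: "'h::real_inner set"
  assumes "finite B"
  shows "\<exists>p\<in>span B. \<forall>u\<in>span B. (v - p) \<bullet> u = 0"
  using assms
proof (induction B arbitrary: v rule: finite_induct)
  case empty
  then show ?case by simp
next
  case (insert b B)
  obtain p where p: "p \<in> span B" "\<And>u. u \<in> span B \<Longrightarrow> (v - p) \<bullet> u = 0"
    using insert.IH[of v] by blast
  obtain s where s: "s \<in> span B" "\<And>u. u \<in> span B \<Longrightarrow> (b - s) \<bullet> u = 0"
    using insert.IH[of b] by blast
  define r where "r = b - s"
  define t where "t = (if r = 0 then 0 else (v \<bullet> r) / (r \<bullet> r))"
  have sB: "span B \<subseteq> span (insert b B)" by (intro span_mono) auto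
  have r: "r \<in> span (insert b B)"
    unfolding r_def using sB s(1) by (intro span_diff[OF span_base]) auto
  show ?case
  proof (intro bexI ballI)
    show "p + t *\<^sub>R r \<in> span (insert b B)"
      using p(1) sB r by (auto intro!: span_add span_scale)
    fix u assume "u \<in> span (insert b B)"
    then obtain k where k: "u - k *\<^sub>R b \<in> span B" by (auto simp: span_insert)
    define u' where "u' = u - k *\<^sub>R r"
    have "u' = (u - k *\<^sub>R b) + k *\<^sub>R s" by (simp add: u'_def r_def algebra_simps)
    then have u': "u' \<in> span B" using k s(1) by (auto intro!: span_add span_scale)
    have u: "u = u' + k *\<^sub>R r" by (simp add: u'_def)
    have "r \<bullet> u' = 0" "(v - p) \<bullet> u' = 0" "r \<bullet> p = 0"
      using s(2) p u' by (auto simp: r_def)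
    moreover have "v \<bullet> r = t * (r \<bullet> r)" by (simp add: t_def)
    ultimately show "(v - (p + t *\<^sub>R r)) \<bullet> u = 0"
      by (simp add: u inner_diff_left inner_add_left inner_add_right inner_commute
          algebra_simps)
  qed
qed

locale vacuum_space =
  fixes d :: nat and X :: "nat \<Rightarrow> ('h::{real_inner, complete_space}) operator" and \<phi> :: 'h
  assumes prob: "noncomm_prob_space d X \<phi>"
begin

definition FF :: "int \<Rightarrow> 'h set" where
  "FF n = (if n < 0 then {0} else F_space d X \<phi> (nat n))"

abbreviation "V \<equiv> vacuum_domain d X \<phi>"
abbreviation "GG \<equiv> G_space d X \<phi>"

lemma FF_span: "\<exists>B. finite B \<and> FF n = span B"
proof (cases "n < 0")
  case True
  then show ?thesis by (intro exI[of _ "{}"]) (simp add: FF_def)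
next
  case False
  have "finite {w. set w \<subseteq> {1..d} \<and> length w \<le> nat n}"
    by (rule finite_lists_length_le) simp
  then show ?thesis using False by (auto simp: FF_def F_space_eq_span[OF prob])
qed

lemma subspace_FF: "subspace (FF n)"
  using FF_span[of n] by auto

lemma FF_mono: assumes "m \<le> n" shows "FF m \<subseteq> FF n"
proof (cases "m < 0")
  case True
  then show ?thesis using subspace_0[OF subspace_FF[of n]] by (simp add: FF_def[of m])
next
  case False
  then have "nat m \<le> nat n" "\<not> n < 0" using assms by auto
  then show ?thesis unfolding FF_def F_space_eq_span[OF prob] using False
    by (simp only: if_False) (intro span_mono, auto)
qed

lemma G_eq: "GG n = {v \<in> FF n. \<forall>u\<in>FF (n - 1). v \<bullet> u = 0}"
  using subspace_0[OF subspace_FF[of n]]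
  by (cases n "0::int" rule: linorder_cases) (auto simp: G_space_def FF_def orthogonal_def)

lemma X_props:
  assumes "i \<in> {1..d}"
  shows "linear_operator (X i)" "symmetric_operator (X i)"
  using prob assms by (auto simp: noncomm_prob_space_def)

lemma word_dom: "set w \<subseteq> {1..d} \<Longrightarrow> \<phi> \<in> dom (op_word X w)"
  using prob op_word_in_algebra unfolding noncomm_prob_space_def by blast

lemma X_FF_nat:
  assumes i: "i \<in> {1..d}" and v: "v \<in> F_space d X \<phi> n"
  shows "v \<in> dom (X i) \<and> the (X i v) \<in> F_space d X \<phi> (Suc n)"
  using v unfolding F_space_eq_span[OF prob, of n]
proof (induction rule: span_induct_alt)
  case base
  have L: "linear_operator (X i)" using X_props[OF i] by simp
  from linear_operator_zero[OF this] show ?case by (auto simp: F_space_eq_span[OF prob] span_zero)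
next
  case (step c x y)
  then obtain w where w: "set w \<subseteq> {1..d}" "length w \<le> n" "x = the (op_word X w \<phi>)" by auto
  have L: "linear_operator (X i)" using X_props[OF i] by simp
  have "\<phi> \<in> dom (op_word X (i # w))" using w i by (intro word_dom) auto
  then have x: "x \<in> dom (X i)" "the (X i x) = the (op_word X (i # w) \<phi>)"
    using w(3) by (auto simp: op_word_simps map_comp_def split: option.splits)
  have "the (X i x) \<in> F_space d X \<phi> (Suc n)"
    unfolding x(2) F_space_eq_span[OF prob] using w i by (intro span_base imageI) auto
  moreover have "c *\<^sub>R x \<in> dom (X i)" using L x subspace_scale unfolding linear_operator_def by metis
  moreover have "the (X i (c *\<^sub>R x + y)) = c *\<^sub>R the (X i x) + the (X i y)"
    using L x \<open>c *\<^sub>R x \<in> dom (X i)\<close> step.IH unfolding linear_operator_def by metis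
  moreover have "c *\<^sub>R x + y \<in> dom (X i)"
    using L \<open>c *\<^sub>R x \<in> dom (X i)\<close> step.IH subspace_add
    unfolding linear_operator_def by metis
  ultimately show ?case using step.IH
    by (simp add: F_space_eq_span[OF prob] span_add span_scale)
qed

lemma V_eq: "V = (\<Union>n. F_space d X \<phi> n)"
proof
  define D where "D = (\<Union>n. F_space d X \<phi> n)"
  have mono: "F_space d X \<phi> m \<subseteq> F_space d X \<phi> n" if "m \<le> n" for m n
    using FF_mono[of "int m" "int n"] that by (simp add: FF_def)
  have sp: "subspace (F_space d X \<phi> n)" for n
    using subspace_FF[of "int n"] by (simp add: FF_def)
  have phi: "\<phi> \<in> D"
    unfolding D_def F_space_eq_span[OF prob]
    by (intro UN_I[of 0] span_base image_eqI[of _ _ "[]"]) (auto simp: op_word_simps)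
  have addD: "x + y \<in> D" if "x \<in> D" "y \<in> D" for x y
  proof -
    from that obtain m n where "x \<in> F_space d X \<phi> m" "y \<in> F_space d X \<phi> n" by (auto simp: D_def)
    then have "x \<in> F_space d X \<phi> (max m n)" "y \<in> F_space d X \<phi> (max m n)"
      using mono[of m "max m n"] mono[of n "max m n"] by auto
    then have "x + y \<in> F_space d X \<phi> (max m n)" by (rule subspace_add[OF sp])
    then show ?thesis unfolding D_def by blast
  qed
  have "\<forall>v\<in>D. v \<in> dom g \<and> the (g v) \<in> D" if "g \<in> generated_algebra (X ` {1..d})" for g
    using that
  proof induction
    case one
    then show ?case by simp
  next
    case (generator T)
    then show ?case using X_FF_nat unfolding D_def by blast
  next
    case (add A B)
    then show ?case by (auto simp: op_add_def intro!: addD)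
  next
    case (scale A r)
    have "r *\<^sub>R x \<in> D" if "x \<in> D" for x
      using that subspace_scale[OF sp] unfolding D_def by blast
    then show ?case using scale by (fastforce simp: op_scale_def dom_def)
  next
    case (mult A B)
    show ?case
    proof
      fix v assume "v \<in> D"
      then obtain y where y: "B v = Some y" "y \<in> D" using mult.IH(2) by force
      then obtain z where z: "A y = Some z" "z \<in> D" using mult.IH(1) by force
      show "v \<in> dom (A \<circ>\<^sub>m B) \<and> the ((A \<circ>\<^sub>m B) v) \<in> D" using y z by (auto simp: map_comp_def)
    qed
  qed
  with phi show "V \<subseteq> (\<Union>n. F_space d X \<phi> n)"
    by (auto simp: vacuum_domain_def prob_algebra_def D_def)
  have "v \<in> V" if "v \<in> F_space d X \<phi> n" for v n
    using that unfolding F_space_eq_span[OF prob]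
  proof (induction rule: span_induct_alt)
    case base
    have "op_scale 0 op_id \<in> prob_algebra d X"
      by (auto simp: prob_algebra_def intro: generated_algebra.intros)
    then show ?case unfolding vacuum_domain_def by (force simp: op_scale_def)
  next
    case (step c x y)
    then obtain w g where w: "set w \<subseteq> {1..d}" "x = the (op_word X w \<phi>)"
      and g: "g \<in> prob_algebra d X" "y = the (g \<phi>)" by (auto simp: vacuum_domain_def)
    have "op_add (op_scale c (op_word X w)) g \<in> prob_algebra d X"
      using op_word_in_algebra[OF w(1), of X] g(1)
      by (auto simp: prob_algebra_def intro: generated_algebra.intros)
    moreover have "the (op_add (op_scale c (op_word X w)) g \<phi>) = c *\<^sub>R x + y"
    proof -
      have "\<phi> \<in> dom g" using prob g by (auto simp: noncomm_prob_space_def)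
      then show ?thesis using word_dom[OF w(1)] w(2) g(2)
        by (auto simp: op_add_def op_scale_def)
    qed
    ultimately show ?case unfolding vacuum_domain_def by (metis (mono_tags, lifting) mem_Collect_eq)
  qed
  then show "(\<Union>n. F_space d X \<phi> n) \<subseteq> V" by blast
qed

lemma V_FF: "V = (\<Union>n. FF n)"
proof -
  have "FF n \<subseteq> FF (int (nat n))" for n by (rule FF_mono) simp
  then have "(\<Union>n. FF n) = (\<Union>n. FF (int n))" by blast
  then show ?thesis by (simp add: V_eq FF_def)
qed

lemma FF_V: "FF n \<subseteq> V" by (auto simp: V_FF)

lemma X_FF:
  assumes i: "i \<in> {1..d}" and v: "v \<in> FF n"
  shows "v \<in> dom (X i)" "the (X i v) \<in> FF (n + 1)"
proof -
  have "v \<in> dom (X i) \<and> the (X i v) \<in> FF (n + 1)"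
  proof (cases "n < 0")
    case True
    have L: "linear_operator (X i)" using X_props[OF i] by simp
    from linear_operator_zero[OF this] True v show ?thesis using subspace_0[OF subspace_FF] by (simp add: FF_def[of n])
  next
    case False
    then show ?thesis using X_FF_nat[OF i, of v "nat n"] v
      by (simp add: FF_def Suc_nat_eq_nat_zadd1 add.commute)
  qed
  then show "v \<in> dom (X i)" "the (X i v) \<in> FF (n + 1)" by auto
qed

lemma subspace_V: "subspace V"
  unfolding subspace_def
proof (intro conjI allI impI ballI)
  show "0 \<in> V" using FF_V[of 0] subspace_0[OF subspace_FF[of 0]] by auto
next
  fix x y assume "x \<in> V" "y \<in> V"
  then obtain m n where "x \<in> FF m" "y \<in> FF n" by (auto simp: V_FF)
  then have "x \<in> FF (max m n)" "y \<in> FF (max m n)"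
    using FF_mono[of m "max m n"] FF_mono[of n "max m n"] by auto
  then have "x + y \<in> FF (max m n)" by (rule subspace_add[OF subspace_FF])
  then show "x + y \<in> V" using FF_V by auto
next
  fix x and c :: real assume "x \<in> V"
  then obtain n where "x \<in> FF n" by (auto simp: V_FF)
  then have "c *\<^sub>R x \<in> FF n" by (rule subspace_scale[OF subspace_FF])
  then show "c *\<^sub>R x \<in> V" using FF_V by auto
qed

text \<open>\<open>Q n\<close> and \<open>E n\<close> are the orthogonal projections onto \<open>FF n\<close> and \<open>GG n\<close>.\<close>

definition Q :: "int \<Rightarrow> 'h \<Rightarrow> 'h" where
  "Q n v = (SOME p. p \<in> FF n \<and> (\<forall>u\<in>FF n. (v - p) \<bullet> u = 0))"

lemma Q_props: "Q n v \<in> FF n" "u \<in> FF n \<Longrightarrow> (v - Q n v) \<bullet> u = 0"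
proof -
  obtain B where "finite B" "FF n = span B" using FF_span by blast
  then have "\<exists>p. p \<in> FF n \<and> (\<forall>u\<in>FF n. (v - p) \<bullet> u = 0)"
    using finite_span_projection[of B v] by auto
  from someI_ex[OF this] show "Q n v \<in> FF n" "u \<in> FF n \<Longrightarrow> (v - Q n v) \<bullet> u = 0"
    by (auto simp: Q_def)
qed

lemma Q_unique:
  assumes "p \<in> FF n" "\<And>u. u \<in> FF n \<Longrightarrow> (v - p) \<bullet> u = 0"
  shows "Q n v = p"
proof -
  have m: "Q n v - p \<in> FF n" by (intro subspace_diff[OF subspace_FF] Q_props(1) assms(1))
  have "(Q n v - p) \<bullet> (Q n v - p) = (v - p) \<bullet> (Q n v - p) - (v - Q n v) \<bullet> (Q n v - p)"
    by (simp add: inner_diff_left)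
  also have "\<dots> = 0" using assms(2)[OF m] Q_props(2)[OF m] by simp
  finally show ?thesis by simp
qed

lemma Q_id: "v \<in> FF n \<Longrightarrow> Q n v = v" by (rule Q_unique) auto

lemma Q_add: "Q n (u + v) = Q n u + Q n v"
proof (rule Q_unique)
  show "Q n u + Q n v \<in> FF n" by (intro subspace_add[OF subspace_FF] Q_props(1))
  fix w assume "w \<in> FF n"
  then show "(u + v - (Q n u + Q n v)) \<bullet> w = 0"
    using Q_props(2)[of w n u] Q_props(2)[of w n v] by (simp add: inner_diff_left inner_add_left)
qed

lemma Q_scale: "Q n (r *\<^sub>R v) = r *\<^sub>R Q n v"
proof (rule Q_unique)
  show "r *\<^sub>R Q n v \<in> FF n" by (intro subspace_scale[OF subspace_FF] Q_props(1))
  fix w assume "w \<in> FF n"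
  then show "(r *\<^sub>R v - r *\<^sub>R Q n v) \<bullet> w = 0"
    using Q_props(2)[of w n v] by (simp add: inner_diff_left)
qed

definition E :: "int \<Rightarrow> 'h \<Rightarrow> 'h" where "E n v = Q n v - Q (n - 1) v"

lemma E_G: "E n v \<in> GG n"
proof -
  have "Q (n - 1) v \<in> FF n" using Q_props(1) FF_mono[of "n - 1" n] by fastforce
  then have 1: "E n v \<in> FF n" unfolding E_def by (intro subspace_diff[OF subspace_FF] Q_props(1))
  have "E n v \<bullet> u = 0" if "u \<in> FF (n - 1)" for u
  proof -
    have "u \<in> FF n" using that FF_mono[of "n - 1" n] by auto
    then show ?thesis using Q_props(2)[of u n v] Q_props(2)[OF that, of v]
      by (simp add: E_def inner_diff_left)
  qed
  with 1 show ?thesis by (simp add: G_eq)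
qed

lemma subspace_G: "subspace (GG n)"
  unfolding G_eq using subspace_FF[of n]
  by (auto simp: subspace_def inner_add_left)

lemma E_add: "E n (u + v) = E n u + E n v" by (simp add: E_def Q_add)
lemma E_scale: "E n (r *\<^sub>R v) = r *\<^sub>R E n v" by (simp add: E_def Q_scale algebra_simps)
lemma E_zero_eq: "E n 0 = 0" using E_scale[of n 0 0] by simp

lemma E_above: "v \<in> FF m \<Longrightarrow> m < n \<Longrightarrow> E n v = 0"
  using FF_mono[of m n] FF_mono[of m "n - 1"] by (auto simp: E_def Q_id subset_iff)

lemma E_neg: "n < 0 \<Longrightarrow> E n v = 0"
  using E_G[of n v] by (simp add: G_space_def)

lemma G_FF: "v \<in> GG n \<Longrightarrow> v \<in> FF n" by (simp add: G_eq)

lemma Q_zero: assumes "\<And>u. u \<in> FF n \<Longrightarrow> v \<bullet> u = 0" shows "Q n v = 0"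
  by (rule Q_unique) (use assms subspace_0[OF subspace_FF] in auto)

lemma E_on_G: assumes "v \<in> GG m" shows "E n v = (if n = m then v else 0)"
proof -
  have below: "Q n v = 0" if "n < m" for n
    using assms FF_mono[of n "m - 1"] that by (intro Q_zero) (auto simp: G_eq subset_iff)
  show ?thesis
  proof (cases n m rule: linorder_cases)
    case less
    then show ?thesis by (simp add: E_def below)
  next
    case equal
    then show ?thesis using G_FF[OF assms] by (simp add: E_def below Q_id)
  next
    case greater
    then show ?thesis using G_FF[OF assms] E_above by simp
  qed
qed

lemma sum_E: "v \<in> FF (int N) \<Longrightarrow> v = (\<Sum>n\<le>N. E (int n) v)"
proof -
  have "(\<Sum>n\<le>N. E (int n) v) = Q (int N) v - Q (- 1) v"
    by (induction N) (simp_all add: E_def)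
  moreover have "Q (- 1) v = 0" using Q_props(1)[of "- 1" v] by (simp add: FF_def)
  ultimately show "v = (\<Sum>n\<le>N. E (int n) v)" if "v \<in> FF (int N)" using that Q_id by simp
qed

lemma V_bound: "v \<in> V \<Longrightarrow> \<exists>N::nat. v \<in> FF (int N)"
  by (auto simp: V_eq FF_def)

text \<open>The part of \<open>X i\<close> mapping each \<open>GG n\<close> into \<open>GG (n + s)\<close>.\<close>

definition shift_part :: "nat \<Rightarrow> int \<Rightarrow> 'h \<Rightarrow> 'h" where
  "shift_part i s v = (\<Sum>n | E (int n) v \<noteq> 0. E (int n + s) (the (X i (E (int n) v))))"

lemma X_dom: "i \<in> {1..d} \<Longrightarrow> v \<in> V \<Longrightarrow> v \<in> dom (X i)"
  using X_FF(1) by (auto simp: V_FF)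

lemma X_V_add: "i \<in> {1..d} \<Longrightarrow> u \<in> V \<Longrightarrow> v \<in> V \<Longrightarrow> the (X i (u + v)) = the (X i u) + the (X i v)"
  using X_props(1)[of i] X_dom[of i] unfolding linear_operator_def by blast

lemma X_V_scale: "i \<in> {1..d} \<Longrightarrow> v \<in> V \<Longrightarrow> the (X i (r *\<^sub>R v)) = r *\<^sub>R the (X i v)"
  using X_props(1)[of i] X_dom[of i] unfolding linear_operator_def by blast

lemma X_V_0: "i \<in> {1..d} \<Longrightarrow> the (X i 0) = 0"
  using X_V_scale[of i 0 0] subspace_0[OF subspace_V] by simp

lemma X_V_sum: "i \<in> {1..d} \<Longrightarrow> finite A \<Longrightarrow> (\<And>a. a \<in> A \<Longrightarrow> f a \<in> V) \<Longrightarrow>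
   the (X i (\<Sum>a\<in>A. f a)) = (\<Sum>a\<in>A. the (X i (f a)))"
  by (induction A rule: infinite_finite_induct) 
     (auto simp: X_V_0 X_V_add subspace_sum[OF subspace_V])

lemma E_V: "E n v \<in> V" using G_FF[OF E_G] FF_V by blast

lemma shift_part_eq:
  assumes "i \<in> {1..d}" "v \<in> FF (int N)"
  shows "shift_part i s v = (\<Sum>n\<le>N. E (int n + s) (the (X i (E (int n) v))))"
  unfolding shift_part_def
proof (rule sum.mono_neutral_left)
  show "{n. E (int n) v \<noteq> 0} \<subseteq> {..N}"
    using E_above[OF assms(2)] by (force simp: not_le[symmetric])
qed (use assms in \<open>auto simp: X_V_0 E_zero_eq\<close>)

lemma shift_part_V: "shift_part i s v \<in> V"
  unfolding shift_part_def by (intro subspace_sum[OF subspace_V] E_V)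

lemma shift_part_add:
  assumes i: "i \<in> {1..d}" and "u \<in> V" "v \<in> V"
  shows "shift_part i s (u + v) = shift_part i s u + shift_part i s v"
proof -
  from assms obtain M N where "u \<in> FF (int M)" "v \<in> FF (int N)" using V_bound by blast
  then have uv: "u \<in> FF (int (max M N))" "v \<in> FF (int (max M N))"
    using FF_mono[of "int M" "int (max M N)"] FF_mono[of "int N" "int (max M N)"] by auto
  have uv': "u + v \<in> FF (int (max M N))" using uv by (intro subspace_add[OF subspace_FF])
  show ?thesis
    unfolding shift_part_eq[OF i uv(1)] shift_part_eq[OF i uv(2)] shift_part_eq[OF i uv']
    by (simp add: E_add X_V_add[OF i] E_V sum.distrib)
qed

lemma shift_part_scale:
  assumes i: "i \<in> {1..d}" and "v \<in> V"
  shows "shift_part i s (r *\<^sub>R v) = r *\<^sub>R shift_part i s v"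
proof -
  from assms obtain N where v: "v \<in> FF (int N)" using V_bound by blast
  have v': "r *\<^sub>R v \<in> FF (int N)" using v by (intro subspace_scale[OF subspace_FF])
  show ?thesis
    unfolding shift_part_eq[OF i v] shift_part_eq[OF i v']
    by (simp add: E_scale X_V_scale[OF i] E_V scaleR_sum_right)
qed

lemma shift_part_G:
  assumes i: "i \<in> {1..d}" and v: "v \<in> GG n" and n: "n \<ge> 0"
  shows "shift_part i s v = E (n + s) (the (X i v))"
proof -
  have "v \<in> FF (int (nat n))" using G_FF[OF v] n by simp
  from shift_part_eq[OF i this] have "shift_part i s v = (\<Sum>m\<le>nat n. E (int m + s) (the (X i (E (int m) v))))" .
  also have "\<dots> = (\<Sum>m\<le>nat n. if m = nat n then E (n + s) (the (X i v)) else 0)"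
    using v n by (intro sum.cong) (auto simp: E_on_G X_V_0[OF i] E_zero_eq)
  also have "\<dots> = E (n + s) (the (X i v))" by simp
  finally show ?thesis .
qed

lemma X_G_three:
  assumes i: "i \<in> {1..d}" and v: "v \<in> GG n"
  shows "the (X i v) = E (n - 1) (the (X i v)) + E n (the (X i v)) + E (n + 1) (the (X i v))"
proof -
  have "Q (n - 2) (the (X i v)) = 0"
  proof (rule Q_zero)
    fix u assume u: "u \<in> FF (n - 2)"
    have Xu: "the (X i u) \<in> FF (n - 1)" using X_FF(2)[OF i u] by simp
    have "the (X i v) \<bullet> u = v \<bullet> the (X i u)"
      using X_props(2)[OF i] X_FF(1)[OF i u] X_FF(1)[OF i G_FF[OF v]]
      by (simp add: symmetric_operator_def)
    then show "the (X i v) \<bullet> u = 0" using v Xu by (simp add: G_eq)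
  qed
  moreover have "Q (n + 1) (the (X i v)) = the (X i v)"
    using Q_id X_FF(2)[OF i G_FF[OF v]] by simp
  ultimately show ?thesis by (simp add: E_def)
qed

lemma shift_part_total:
  assumes i: "i \<in> {1..d}" and v: "v \<in> V"
  shows "the (X i v) = shift_part i (- 1) v + (shift_part i 0 v + shift_part i 1 v)"
proof -
  obtain N where v: "v \<in> FF (int N)" using v V_bound by blast
  have "the (X i v) = the (X i (\<Sum>n\<le>N. E (int n) v))" by (simp only: sum_E[OF v, symmetric])
  also have "\<dots> = (\<Sum>n\<le>N. the (X i (E (int n) v)))" by (simp add: X_V_sum[OF i] E_V)
  also have "\<dots> = (\<Sum>n\<le>N. E (int n - 1) (the (X i (E (int n) v))) + E (int n) (the (X i (E (int n) v)))
      + E (int n + 1) (the (X i (E (int n) v))))"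
    by (rule sum.cong) (use X_G_three[OF i E_G] in auto)
  finally show ?thesis by (simp add: shift_part_eq[OF i v] sum.distrib add.assoc)
qed

lemma G_indep:
  assumes "x \<in> GG (n - 1)" "y \<in> GG n" "z \<in> GG (n + 1)"
    and "x' \<in> GG (n - 1)" "y' \<in> GG n" "z' \<in> GG (n + 1)"
    and eq: "x + (y + z) = x' + (y' + z')"
  shows "x = x' \<and> y = y' \<and> z = z'"
proof -
  have "E m (x + (y + z)) = E m (x' + (y' + z'))" for m using eq by simp
  from this[of "n - 1"] this[of n] this[of "n + 1"] show ?thesis
    by (simp add: E_add E_on_G[OF assms(1)] E_on_G[OF assms(2)] E_on_G[OF assms(3)]
         E_on_G[OF assms(4)] E_on_G[OF assms(5)] E_on_G[OF assms(6)])
qed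

lemma linear_operator_ext:
  assumes S: "linear_operator S" "dom S = V" and T: "linear_operator T" "dom T = V"
    and eq: "\<And>n v. n \<ge> 0 \<Longrightarrow> v \<in> GG n \<Longrightarrow> the (S v) = the (T v)"
  shows "S = T"
proof
  fix v show "S v = T v"
  proof (cases "v \<in> V")
    case False
    then show ?thesis using S T by (metis domIff)
  next
    case True
    have sum: "the (R (\<Sum>a\<le>N. f a)) = (\<Sum>a\<le>N. the (R (f a)))"
      if R: "linear_operator R" "dom R = V" and f: "\<And>a. f a \<in> V" for R f and N :: nat
    proof (induction N)
      case (Suc N)
      have "(\<Sum>a\<le>N. f a) \<in> V" by (intro subspace_sum[OF subspace_V] f)
      then have "the (R ((\<Sum>a\<le>N. f a) + f (Suc N))) = the (R (\<Sum>a\<le>N. f a)) + the (R (f (Suc N)))"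
        using R f[of "Suc N"] unfolding linear_operator_def by blast
      then show ?case using Suc by simp
    qed simp
    obtain N where N: "v \<in> FF (int N)" using True V_bound by blast
    have "the (S v) = (\<Sum>n\<le>N. the (S (E (int n) v)))"
      using sum[OF S, of "\<lambda>n. E (int n) v" N, OF E_V] unfolding sum_E[OF N, symmetric] .
    also have "\<dots> = (\<Sum>n\<le>N. the (T (E (int n) v)))"
      by (intro sum.cong eq[OF _ E_G]) auto
    also have "\<dots> = the (T v)"
      using sum[OF T, of "\<lambda>n. E (int n) v" N, OF E_V] unfolding sum_E[OF N, symmetric] by simp
    finally show ?thesis using True S(2) T(2) by (metis domD option.sel)
  qed
qed

lemma apc_ex1:
  assumes i: "i \<in> {1..d}"
  shows "\<exists>!t. apc_decomposition d X \<phi> i t"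
proof (rule ex_ex1I)
  define T where "T s = (\<lambda>v. if v \<in> V then Some (shift_part i s v) else None)" for s
  have dT: "dom (T s) = V" for s by (auto simp: T_def dom_def)
  have lT: "linear_operator (T s)" for s
    unfolding linear_operator_def dT using subspace_V
    by (auto simp: T_def shift_part_add[OF i] shift_part_scale[OF i] subspace_add subspace_scale)
  have "X i |` V = op_add (T (- 1)) (op_add (T 0) (T 1))"
  proof
    fix v show "(X i |` V) v = op_add (T (- 1)) (op_add (T 0) (T 1)) v"
    proof (cases "v \<in> V")
      case True
      then obtain y where "X i v = Some y" using X_FF(1)[OF i] by (auto simp: V_FF)
      then show ?thesis using True shift_part_total[OF i True]
        by (simp add: op_add_def T_def dom_def)
    next
      case False
      then show ?thesis by (simp add: op_add_def T_def dom_def)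
    qed
  qed
  moreover have "the (T s v) \<in> GG (n + s)" if "n \<ge> 0" "v \<in> GG n" for s n v
    using shift_part_G[OF i that(2,1), of s] E_G FF_V G_FF[OF that(2)] by (auto simp: T_def)
  from this[of _ _ "- 1"] this[of _ _ 0] this[of _ _ 1]
  have "\<forall>n\<ge>0. \<forall>v\<in>GG n. the (T (- 1) v) \<in> GG (n - 1) \<and> the (T 0 v) \<in> GG n \<and> the (T 1 v) \<in> GG (n + 1)"
    by simp
  ultimately show "\<exists>t. apc_decomposition d X \<phi> i t"
    by (intro exI[of _ "(T (- 1), T 0, T 1)"]) (auto simp: apc_decomposition_def lT dT)
next
  fix t t' assume 1: "apc_decomposition d X \<phi> i t" and 2: "apc_decomposition d X \<phi> i t'"
  obtain a b c where t: "t = (a, b, c)" by (cases t)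
  obtain a' b' c' where t': "t' = (a', b', c')" by (cases t')
  have "the (a v) = the (a' v) \<and> the (b v) = the (b' v) \<and> the (c v) = the (c' v)"
    if n: "n \<ge> 0" and v: "v \<in> GG n" for n v
  proof (rule G_indep)
    have vV: "v \<in> V" using G_FF[OF v] FF_V by blast
    have "op_add a (op_add b c) v = op_add a' (op_add b' c') v"
      using 1 2 unfolding t t' apc_decomposition_def by simp
    moreover have "dom a = V" "dom b = V" "dom c = V" "dom a' = V" "dom b' = V" "dom c' = V"
      using 1 2 unfolding t t' apc_decomposition_def by auto
    ultimately show "the (a v) + (the (b v) + the (c v)) = the (a' v) + (the (b' v) + the (c' v))"
      using vV by (auto simp: op_add_def domIff)
  qed (use 1 2 n v in \<open>auto simp: t t' apc_decomposition_def\<close>)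
  moreover have "linear_operator a" "linear_operator b" "linear_operator c"
    "linear_operator a'" "linear_operator b'" "linear_operator c'"
    "dom a = V" "dom b = V" "dom c = V" "dom a' = V" "dom b' = V" "dom c' = V"
    using 1 2 unfolding t t' apc_decomposition_def by auto
  ultimately show "t = t'" unfolding t t' using linear_operator_ext by simp
qed

end

theorem apc_decomposition_ex1:
  assumes "noncomm_prob_space d X \<phi>" and "i \<in> {1..d}"
  shows "\<exists>!t. apc_decomposition d X \<phi> i t"
  using vacuum_space.apc_ex1[of d X \<phi> i] assms by (simp add: vacuum_space_def)

end

theory Submission imports Defs begin

text \<open>
  Why the moments are diagram sums. The preservation operators vanish, so that
  \<open>X i\<close> is the sum of its annihilation part \<open>an i\<close> and its creation part \<open>cr i\<close> on the cyclic
  space of the vacuum. Indeed, a vector of \<open>G n\<close> with \<open>n > 0\<close> that every annihilation operator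
  kills is zero (\<open>annihilated_zero\<close>): \<open>F n\<close> is spanned by the vacuum and the vectors \<open>X i u\<close> with
  \<open>u\<close> in \<open>F (n - 1)\<close>, and by symmetry of \<open>X i\<close> such a vector is orthogonal to all of them.
  The relation \<open>an i (pr j v) = q pr j (an i v)\<close> then carries the vanishing of the preservation
  part \<open>pr j\<close> from \<open>G n\<close> to \<open>G (n + 1)\<close>, and it starts because \<open>X j\<close> is centered
  (\<open>preservation_zero\<close>).

  What remains is a Wick formula. Apply the operators of the word to the vacuum one after the
  other, from right to left. A creation operator at position \<open>p\<close> opens a leg at \<open>p\<close>. An
  annihilation operator at position \<open>m\<close> is commuted to the right through the creation operators
  of the open legs; it closes one leg \<open>p\<close> with the factor \<open>c (\<sigma> m) (\<sigma> p)\<close> and picks up a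
  factor \<open>q\<close> for each open leg between \<open>m\<close> and \<open>p\<close> (\<open>b_state\<close>). In a term that contributes, each of
  these legs is closed later, from the left of \<open>m\<close>, and so belongs to a left crossing of \<open>(m, p)\<close>;
  every left crossing of \<open>(m, p)\<close> arises in this way (\<open>crossing_number_insert\<close>).

  The induction therefore concerns the set \<open>{1..m}\<close> of unprocessed positions together with the
  set \<open>P\<close> of open legs to the right of \<open>m\<close>, and the diagrams on \<open>{1..m} \<union> P\<close> without a pair inside
  \<open>P\<close>. The weighted sum over these diagrams (\<open>diagram_sum_step\<close>) and the vacuum component of the
  word \<open>1 \<dots> m\<close> applied to the vector with open legs \<open>P\<close> obey the same recursion in \<open>m\<close>
  (\<open>word_state_moment\<close>). The case \<open>P = {}\<close> is the theorem.
\<close>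

section \<open>Feynman diagrams with open legs\<close>

text \<open>A complete Feynman diagram given directly by its ordered pairs, without the detour through
  the underlying partition; adding and removing a single pair is easier in this form.\<close>

definition pairing :: "'a::linorder set \<Rightarrow> ('a \<times> 'a) set \<Rightarrow> bool" where
  "pairing S \<gamma> \<longleftrightarrow> \<gamma> \<subseteq> {(i, j). i < j \<and> i \<in> S \<and> j \<in> S} \<and>
     (\<forall>x\<in>S. \<exists>!e. e \<in> \<gamma> \<and> (x = fst e \<or> x = snd e))"

lemma pairing_pair: "pairing S \<gamma> \<Longrightarrow> (i, j) \<in> \<gamma> \<Longrightarrow> i < j \<and> i \<in> S \<and> j \<in> S"
  unfolding pairing_def by auto

lemma pairing_unique:
  assumes "pairing S \<gamma>" "(i, j) \<in> \<gamma>" "(k, l) \<in> \<gamma>" "x = i \<or> x = j" "x = k \<or> x = l"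
  shows "k = i \<and> l = j"
proof -
  have "x \<in> S" using assms pairing_pair by metis
  then have "\<exists>!e. e \<in> \<gamma> \<and> (x = fst e \<or> x = snd e)" using assms(1) by (simp add: pairing_def)
  then have "(i, j) = (k, l)" using assms by (metis fst_conv snd_conv)
  then show ?thesis by simp
qed

lemma pairing_covers:
  assumes "pairing S \<gamma>" "x \<in> S"
  shows "\<exists>y. (x, y) \<in> \<gamma> \<or> (y, x) \<in> \<gamma>"
proof -
  obtain e where "e \<in> \<gamma>" "x = fst e \<or> x = snd e" using assms unfolding pairing_def by blast
  then show ?thesis by (cases e) auto
qed

lemma pairingI:
  assumes "\<And>i j. (i, j) \<in> \<gamma> \<Longrightarrow> i < j \<and> i \<in> S \<and> j \<in> S"
    and "\<And>x. x \<in> S \<Longrightarrow> \<exists>y. (x, y) \<in> \<gamma> \<or> (y, x) \<in> \<gamma>"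
    and "\<And>x i j k l. (i, j) \<in> \<gamma> \<Longrightarrow> (k, l) \<in> \<gamma> \<Longrightarrow> x = i \<or> x = j \<Longrightarrow> x = k \<or> x = l
           \<Longrightarrow> i = k \<and> j = l"
  shows "pairing S \<gamma>"
  unfolding pairing_def
proof (intro conjI ballI)
  show "\<gamma> \<subseteq> {(i, j). i < j \<and> i \<in> S \<and> j \<in> S}" using assms(1) by auto
  fix x assume "x \<in> S"
  then obtain y where "(x, y) \<in> \<gamma> \<or> (y, x) \<in> \<gamma>" using assms(2) by blast
  then obtain e where e: "e \<in> \<gamma>" "x = fst e \<or> x = snd e" by force
  show "\<exists>!e. e \<in> \<gamma> \<and> (x = fst e \<or> x = snd e)"
  proof (rule ex1I[of _ e])
    show "e \<in> \<gamma> \<and> (x = fst e \<or> x = snd e)" using e by simp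
    fix f assume f: "f \<in> \<gamma> \<and> (x = fst f \<or> x = snd f)"
    have "fst f = fst e \<and> snd f = snd e"
      by (rule assms(3)[of _ _ _ _ x]) (use e f in auto)
    then show "f = e" by (simp add: prod_eq_iff)
  qed
qed

lemma complete_feynman_eq: "complete_feynman S = {\<gamma>. pairing S \<gamma>}"
proof (intro subset_antisym subsetI)
  fix \<gamma> assume "\<gamma> \<in> complete_feynman S"
  then obtain P where P: "partition_on S P" "\<And>B. B \<in> P \<Longrightarrow> card B = 2"
    and \<gamma>: "\<gamma> = {(i, j). i < j \<and> {i, j} \<in> P}" by (auto simp: complete_feynman_def)
  have S: "S = \<Union>P" using partition_onD1[OF P(1)] .
  have dis: "B = C" if "B \<in> P" "C \<in> P" "x \<in> B" "x \<in> C" for B C x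
    using partition_onD2[OF P(1)] that by (auto simp: disjoint_def)
  have "pairing S \<gamma>"
  proof (rule pairingI)
    fix i j assume "(i, j) \<in> \<gamma>"
    then show "i < j \<and> i \<in> S \<and> j \<in> S" by (auto simp: \<gamma> S)
  next
    fix x assume "x \<in> S"
    then obtain B where B: "B \<in> P" "x \<in> B" by (auto simp: S)
    then obtain u v where uv: "B = {u, v}" "u \<noteq> v" using P(2)[OF B(1)] by (auto simp: card_2_iff)
    then have "x = u \<or> x = v" using B by auto
    then obtain y where "B = {x, y}" "x \<noteq> y" using uv by auto
    then show "\<exists>y. (x, y) \<in> \<gamma> \<or> (y, x) \<in> \<gamma>"
      using B(1) by (cases x y rule: linorder_cases) (auto simp: \<gamma> insert_commute)
  next
    fix x i j k l assume "(i, j) \<in> \<gamma>" "(k, l) \<in> \<gamma>" "x = i \<or> x = j" "x = k \<or> x = l"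
    then have "{i, j} = {k, l}" "i < j" "k < l"
      using dis[of "{i, j}" "{k, l}" x] by (auto simp: \<gamma>)
    then show "i = k \<and> j = l" by (auto simp: doubleton_eq_iff)
  qed
  then show "\<gamma> \<in> {\<gamma>. pairing S \<gamma>}" by simp
next
  fix \<gamma> assume "\<gamma> \<in> {\<gamma>. pairing S \<gamma>}"
  then have p: "pairing S \<gamma>" by simp
  define P where "P = (\<lambda>(i, j). {i, j}) ` \<gamma>"
  have "partition_on S P"
  proof (rule partition_onI)
    show "\<Union>P = S"
    proof
      show "\<Union>P \<subseteq> S" using pairing_pair[OF p] by (auto simp: P_def)
      show "S \<subseteq> \<Union>P" by (force simp: P_def dest!: pairing_covers[OF p])
    qed
    fix B C assume "B \<in> P" "C \<in> P" "B \<noteq> C"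
    then obtain i j k l where ijkl: "(i, j) \<in> \<gamma>" "(k, l) \<in> \<gamma>" "B = {i, j}" "C = {k, l}"
      by (auto simp: P_def)
    have "x \<notin> C" if "x \<in> B" for x
      using pairing_unique[OF p ijkl(1,2), of x] that ijkl(3,4) \<open>B \<noteq> C\<close> by auto
    then show "disjnt B C" by (auto simp: disjnt_def)
  qed (auto simp: P_def)
  moreover have "\<forall>B\<in>P. card B = 2"
  proof
    fix B assume "B \<in> P"
    then obtain i j where "(i, j) \<in> \<gamma>" "B = {i, j}" by (auto simp: P_def)
    then show "card B = 2" using pairing_pair[OF p, of i j] by auto
  qed
  moreover have "\<gamma> = {(i, j). i < j \<and> {i, j} \<in> P}"
  proof -
    have "(i, j) \<in> \<gamma>" if ij: "i < j" "{i, j} \<in> P" for i j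
    proof -
      obtain k l where kl: "(k, l) \<in> \<gamma>" "{i, j} = {k, l}" using ij(2) by (auto simp: P_def)
      then show ?thesis
        using pairing_pair[OF p kl(1)] ij(1) by (auto simp: doubleton_eq_iff dest: less_asym)
    qed
    moreover have "i < j \<and> {i, j} \<in> P" if "(i, j) \<in> \<gamma>" for i j
      using pairing_pair[OF p that] that by (force simp: P_def)
    ultimately show ?thesis by auto
  qed
  ultimately show "\<gamma> \<in> complete_feynman S" by (auto simp: complete_feynman_def)
qed

lemma complete_feynman_odd:
  assumes "finite S" "odd (card S)"
  shows "complete_feynman S = {}"
proof -
  have "even (card S)" if P: "partition_on S P" "\<forall>B\<in>P. card B = 2" for P
  proof -
    have "card S = (\<Sum>B\<in>P. card B)" using product_partition[OF P(1)] P(2)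
      by (metis card.infinite zero_neq_numeral)
    then show ?thesis using P(2) by simp
  qed
  then show ?thesis using assms(2) by (auto simp: complete_feynman_def)
qed

lemma pairing_insert:
  assumes p: "pairing S \<gamma>" and ij: "i < j" "i \<notin> S" "j \<notin> S"
  shows "pairing (insert i (insert j S)) (insert (i, j) \<gamma>)"
proof (rule pairingI)
  fix x assume "x \<in> insert i (insert j S)"
  then show "\<exists>y. (x, y) \<in> insert (i, j) \<gamma> \<or> (y, x) \<in> insert (i, j) \<gamma>"
    using pairing_covers[OF p, of x] by auto
next
  fix x i' j' k l
  assume "(i', j') \<in> insert (i, j) \<gamma>" "(k, l) \<in> insert (i, j) \<gamma>"
    "x = i' \<or> x = j'" "x = k \<or> x = l"
  then show "i' = k \<and> j' = l"
    using pairing_unique[OF p, of i' j' k l x] pairing_pair[OF p, of i' j']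
      pairing_pair[OF p, of k l] ij by auto
next
  fix k l assume "(k, l) \<in> insert (i, j) \<gamma>"
  then show "k < l \<and> k \<in> insert i (insert j S) \<and> l \<in> insert i (insert j S)"
    using pairing_pair[OF p, of k l] ij(1) by auto
qed

lemma pairing_remove:
  assumes p: "pairing S \<gamma>" and ij: "(i, j) \<in> \<gamma>"
  shows "pairing (S - {i, j}) (\<gamma> - {(i, j)})"
proof (rule pairingI)
  fix k l assume kl: "(k, l) \<in> \<gamma> - {(i, j)}"
  then have g: "(k, l) \<in> \<gamma>" and ne: "\<not> (k = i \<and> l = j)" by auto
  have "x \<noteq> i \<and> x \<noteq> j" if "x = k \<or> x = l" for x
    using pairing_unique[OF p ij g _ that] ne by blast
  then show "k < l \<and> k \<in> S - {i, j} \<and> l \<in> S - {i, j}"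
    using pairing_pair[OF p g] by simp
next
  fix x assume "x \<in> S - {i, j}"
  then show "\<exists>y. (x, y) \<in> \<gamma> - {(i, j)} \<or> (y, x) \<in> \<gamma> - {(i, j)}"
    using pairing_covers[OF p, of x] by auto
next
  fix x i' j' k l
  assume "(i', j') \<in> \<gamma> - {(i, j)}" "(k, l) \<in> \<gamma> - {(i, j)}" "x = i' \<or> x = j'" "x = k \<or> x = l"
  then show "i' = k \<and> j' = l" using pairing_unique[OF p, of i' j' k l x] by simp
qed

text \<open>The elements of \<open>P\<close> are the legs still open, which only the unprocessed positions in \<open>A\<close> may
  close.\<close>

definition open_diagrams :: "'a::linorder set \<Rightarrow> 'a set \<Rightarrow> ('a \<times> 'a) set set" where
  "open_diagrams A P = {\<gamma>. pairing (A \<union> P) \<gamma> \<and> \<gamma> \<inter> P \<times> P = {}}"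

lemma finite_open_diagrams: "finite A \<Longrightarrow> finite P \<Longrightarrow> finite (open_diagrams A P)"
  by (rule finite_subset[of _ "Pow ((A \<union> P) \<times> (A \<union> P))"])
     (auto simp: open_diagrams_def pairing_def)

lemma finite_open_diagram: "finite A \<Longrightarrow> finite P \<Longrightarrow> \<gamma> \<in> open_diagrams A P \<Longrightarrow> finite \<gamma>"
  by (rule finite_subset[of _ "((A \<union> P) \<times> (A \<union> P))"])
     (auto simp: open_diagrams_def pairing_def)

lemma open_diagrams_closed: "open_diagrams A {} = complete_feynman A"
  by (simp add: open_diagrams_def complete_feynman_eq)

lemma open_diagrams_empty: "open_diagrams {} P = (if P = {} then {{}} else {})"
proof (cases "P = {}")
  case False
  then obtain x where x: "x \<in> P" by blast
  have "False" if g: "pairing P \<gamma>" "\<gamma> \<inter> P \<times> P = {}" for \<gamma>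
    using pairing_covers[OF g(1) x] pairing_pair[OF g(1)] g(2) by blast
  then show ?thesis using False by (auto simp: open_diagrams_def)
qed (auto simp: open_diagrams_def pairing_def)

lemma open_diagram_pair:
  assumes \<gamma>: "\<gamma> \<in> open_diagrams A P" and AP: "\<And>x p. x \<in> A \<Longrightarrow> p \<in> P \<Longrightarrow> x < p"
    and ij: "(i, j) \<in> \<gamma>"
  shows "i < j" "i \<in> A" "j \<in> A \<union> P"
proof -
  have p: "pairing (A \<union> P) \<gamma>" "(i, j) \<notin> P \<times> P" using \<gamma> ij by (auto simp: open_diagrams_def)
  show "i < j" "i \<in> A" "j \<in> A \<union> P"
    using pairing_pair[OF p(1) ij] p(2) AP[of j i] by auto
qed

text \<open>The last unprocessed position \<open>m\<close> is either paired with some element of \<open>A\<close> on its left, and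
  then counts as one more open leg, or it closes one of the open legs on its right.\<close>

lemma open_diagrams_step:
  assumes Am: "\<And>x. x \<in> A \<Longrightarrow> x < m" and mP: "\<And>p. p \<in> P \<Longrightarrow> m < p"
  shows "open_diagrams (insert m A) P =
    open_diagrams A (insert m P) \<union> (\<Union>p\<in>P. insert (m, p) ` open_diagrams A (P - {p}))"
    (is "?L = ?R1 \<union> ?R2")
proof (intro subset_antisym subsetI)
  fix \<gamma> assume "\<gamma> \<in> ?L"
  then have p: "pairing (insert m (A \<union> P)) \<gamma>" and disj: "\<gamma> \<inter> P \<times> P = {}"
    by (auto simp: open_diagrams_def)
  show "\<gamma> \<in> ?R1 \<union> ?R2"
  proof (cases "\<exists>x\<in>P. (m, x) \<in> \<gamma>")
    case True
    then obtain x where x: "x \<in> P" "(m, x) \<in> \<gamma>" by blast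
    have "insert m (A \<union> P) - {m, x} = A \<union> (P - {x})"
      using x(1) Am mP by (auto dest: less_asym)
    then have "\<gamma> - {(m, x)} \<in> open_diagrams A (P - {x})"
      using pairing_remove[OF p x(2)] disj by (auto simp: open_diagrams_def)
    moreover have "\<gamma> = insert (m, x) (\<gamma> - {(m, x)})" using x by auto
    ultimately show ?thesis using x(1) by blast
  next
    case False
    have "x \<notin> P" if "(x, m) \<in> \<gamma>" for x
      using pairing_pair[OF p that] mP by (blast dest: less_asym)
    moreover have "(m, m) \<notin> \<gamma>" using pairing_pair[OF p, of m m] by auto
    ultimately have "\<gamma> \<inter> insert m P \<times> insert m P = {}"
      using disj False by blast
    then show ?thesis using p by (auto simp: open_diagrams_def)
  qed
next
  fix \<gamma> assume "\<gamma> \<in> ?R1 \<union> ?R2"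
  then show "\<gamma> \<in> ?L"
  proof
    assume "\<gamma> \<in> ?R1"
    then show ?thesis by (auto simp: open_diagrams_def)
  next
    assume "\<gamma> \<in> ?R2"
    then obtain x \<delta> where x: "x \<in> P" and \<delta>: "\<delta> \<in> open_diagrams A (P - {x})"
      and \<gamma>: "\<gamma> = insert (m, x) \<delta>" by auto
    have "insert m (insert x (A \<union> (P - {x}))) = insert m A \<union> P" using x by auto
    moreover have "pairing (insert m (insert x (A \<union> (P - {x})))) (insert (m, x) \<delta>)"
      using \<delta> x Am mP by (intro pairing_insert) (auto simp: open_diagrams_def dest: less_asym)
    ultimately have "pairing (insert m A \<union> P) \<gamma>" by (simp add: \<gamma>)
    moreover have "\<gamma> \<inter> P \<times> P = {}"
    proof -
      have "x \<notin> A" using x Am mP by (auto dest: less_asym)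
      then have "(i, j) \<notin> P \<times> P" if ij: "(i, j) \<in> \<delta>" for i j
        using open_diagram_pair[OF \<delta> _ ij] less_trans[OF Am mP] by (auto dest: less_asym)
      then show ?thesis using mP by (auto simp: \<gamma>)
    qed
    ultimately show ?thesis by (simp add: open_diagrams_def)
  qed
qed

text \<open>Each remaining leg \<open>b\<close> between \<open>m\<close> and \<open>p\<close> is paired with an element of \<open>A\<close>, which lies to the
  left of \<open>m\<close>; these pairs are exactly the left crossings of \<open>(m, p)\<close>. The new pair is itself
  no left crossing of an old pair, because all old pairs start to the left of \<open>m\<close>.\<close>

lemma crossing_number_insert:
  assumes fin: "finite A" "finite P"
    and Am: "\<And>x. x \<in> A \<Longrightarrow> x < m" and mP: "\<And>p. p \<in> P \<Longrightarrow> m < p"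
    and p: "p \<in> P" and \<gamma>: "\<gamma> \<in> open_diagrams A (P - {p})"
  shows "(m, p) \<notin> \<gamma>"
    and "crossing_number (insert (m, p) \<gamma>) = card {b \<in> P. b < p} + crossing_number \<gamma>"
proof -
  have AP: "\<And>x b. x \<in> A \<Longrightarrow> b \<in> P - {p} \<Longrightarrow> x < b" using Am mP less_trans by blast
  note pair = open_diagram_pair[OF \<gamma> AP]
  have pr: "pairing (A \<union> (P - {p})) \<gamma>" using \<gamma> by (simp add: open_diagrams_def)
  show nin: "(m, p) \<notin> \<gamma>" using pair(2) Am by blast
  have finG: "finite \<gamma>" using finite_open_diagram fin \<gamma> by blast
  have old: "left_crossings (insert (m, p) \<gamma>) e = left_crossings \<gamma> e" if "e \<in> \<gamma>" for e
  proof -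
    obtain i j where e: "e = (i, j)" by (cases e)
    have "i < m" using that pair(2) Am e by blast
    then have "{(k, l) \<in> insert (m, p) \<gamma>. k < i \<and> i < l \<and> l < j}
        = {(k, l) \<in> \<gamma>. k < i \<and> i < l \<and> l < j}" by auto
    then show ?thesis by (simp add: e left_crossings_def)
  qed
  have "bij_betw snd {(k, l) \<in> insert (m, p) \<gamma>. k < m \<and> m < l \<and> l < p} {b \<in> P. b < p}"
    unfolding bij_betw_def
  proof
    show "inj_on snd {(k, l) \<in> insert (m, p) \<gamma>. k < m \<and> m < l \<and> l < p}"
    proof (rule inj_onI, clarify)
      fix k l k' l' assume "(k, l) \<in> insert (m, p) \<gamma>" "(k', l') \<in> insert (m, p) \<gamma>"
        "l < p" "snd (k, l) = snd (k', l')"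
      then show "k = k' \<and> l = l'"
        using pairing_unique[OF pr, of k l k' l l] by auto
    qed
    show "snd ` {(k, l) \<in> insert (m, p) \<gamma>. k < m \<and> m < l \<and> l < p} = {b \<in> P. b < p}"
    proof (intro subset_antisym subsetI)
      fix b assume "b \<in> snd ` {(k, l) \<in> insert (m, p) \<gamma>. k < m \<and> m < l \<and> l < p}"
      then obtain k where "(k, b) \<in> \<gamma>" "m < b" "b < p" by auto
      then show "b \<in> {b \<in> P. b < p}" using pair(3)[of k b] Am by (blast dest: less_asym)
    next
      fix b assume b: "b \<in> {b \<in> P. b < p}"
      then have bA: "b \<notin> A" using Am mP by (auto dest: less_asym)
      have "b \<in> A \<union> (P - {p})" using b by auto
      then obtain k where k: "(k, b) \<in> \<gamma>" using pairing_covers[OF pr] bA pair(2) by blast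
      then have "k < m" "m < b" using pair(2) Am mP b by blast+
      then show "b \<in> snd ` {(k, l) \<in> insert (m, p) \<gamma>. k < m \<and> m < l \<and> l < p}"
        using k b by (intro image_eqI[of _ _ "(k, b)"]) auto
    qed
  qed
  then have "left_crossings (insert (m, p) \<gamma>) (m, p) = card {b \<in> P. b < p}"
    by (simp add: left_crossings_def bij_betw_same_card)
  then show "crossing_number (insert (m, p) \<gamma>) = card {b \<in> P. b < p} + crossing_number \<gamma>"
    using nin finG old by (simp add: crossing_number_def)
qed

definition diagram_sum ::
  "real \<Rightarrow> (nat \<Rightarrow> nat \<Rightarrow> real) \<Rightarrow> ('a::linorder \<Rightarrow> nat) \<Rightarrow> 'a set \<Rightarrow> 'a set \<Rightarrow> real" where
  "diagram_sum q c \<sigma> A P =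
     (\<Sum>\<gamma>\<in>open_diagrams A P. q ^ crossing_number \<gamma> * diagram_weight c \<sigma> \<gamma>)"

lemma diagram_sum_empty: "diagram_sum q c \<sigma> {} P = (if P = {} then 1 else 0)"
  by (simp add: diagram_sum_def open_diagrams_empty crossing_number_def diagram_weight_def)

lemma diagram_sum_step:
  assumes fin: "finite A" "finite P"
    and Am: "\<And>x. x \<in> A \<Longrightarrow> x < m" and mP: "\<And>p. p \<in> P \<Longrightarrow> m < p"
  shows "diagram_sum q c \<sigma> (insert m A) P = diagram_sum q c \<sigma> A (insert m P) +
    (\<Sum>p\<in>P. q ^ card {b \<in> P. b < p} * c (\<sigma> m) (\<sigma> p) * diagram_sum q c \<sigma> A (P - {p}))"
proof -
  let ?f = "\<lambda>\<gamma>. q ^ crossing_number \<gamma> * diagram_weight c \<sigma> \<gamma>"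
  let ?D = "\<lambda>p. insert (m, p) ` open_diagrams A (P - {p})"
  have no: "(m, x) \<notin> \<gamma>" if "x \<in> P" "\<gamma> \<in> open_diagrams A (P - {p})" "p \<in> P" for x p \<gamma>
  proof -
    have "\<And>x b. x \<in> A \<Longrightarrow> b \<in> P - {p} \<Longrightarrow> x < b" using Am mP less_trans by blast
    from open_diagram_pair(2)[OF that(2) this] show ?thesis using Am by blast
  qed
  have D: "sum ?f (?D p) =
      q ^ card {b \<in> P. b < p} * c (\<sigma> m) (\<sigma> p) * diagram_sum q c \<sigma> A (P - {p})" if p: "p \<in> P" for p
  proof -
    have "inj_on (insert (m, p)) (open_diagrams A (P - {p}))"
      by (rule inj_onI) (use no[OF p _ p] in \<open>blast dest: insert_ident[THEN iffD1, rotated 2]\<close>)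
    then have "sum ?f (?D p) = (\<Sum>\<gamma>\<in>open_diagrams A (P - {p}). ?f (insert (m, p) \<gamma>))"
      by (simp add: sum.reindex)
    also have "\<dots> = (\<Sum>\<gamma>\<in>open_diagrams A (P - {p}).
        q ^ card {b \<in> P. b < p} * c (\<sigma> m) (\<sigma> p) * ?f \<gamma>)"
    proof (rule sum.cong)
      fix \<gamma> assume \<gamma>: "\<gamma> \<in> open_diagrams A (P - {p})"
      have "finite \<gamma>" using finite_open_diagram fin \<gamma> by blast
      then have "diagram_weight c \<sigma> (insert (m, p) \<gamma>) = c (\<sigma> m) (\<sigma> p) * diagram_weight c \<sigma> \<gamma>"
        using crossing_number_insert(1)[OF fin Am mP p \<gamma>] by (simp add: diagram_weight_def)
      then show "?f (insert (m, p) \<gamma>) = q ^ card {b \<in> P. b < p} * c (\<sigma> m) (\<sigma> p) * ?f \<gamma>"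
        using crossing_number_insert(2)[OF fin Am mP p \<gamma>] by (simp add: power_add)
    qed simp
    finally show ?thesis by (simp add: diagram_sum_def sum_distrib_left)
  qed
  have finD: "finite (?D p)" for p using fin by (simp add: finite_open_diagrams)
  have "sum ?f (\<Union>p\<in>P. ?D p) = (\<Sum>p\<in>P. sum ?f (?D p))"
  proof (rule sum.UNION_disjoint)
    show "\<forall>p\<in>P. \<forall>p'\<in>P. p \<noteq> p' \<longrightarrow> ?D p \<inter> ?D p' = {}"
    proof (intro ballI impI)
      fix p p' assume "p \<in> P" "p' \<in> P" "p \<noteq> p'"
      then show "?D p \<inter> ?D p' = {}" using no[of p _ p'] by auto
    qed
  qed (use fin finD in auto)
  moreover have "open_diagrams A (insert m P) \<inter> (\<Union>p\<in>P. ?D p) = {}"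
    by (auto simp: open_diagrams_def)
  ultimately show ?thesis
    using fin finD D
    by (simp add: diagram_sum_def open_diagrams_step[OF Am mP] sum.union_disjoint
        finite_open_diagrams)
qed

section \<open>The Wick formula for q-commuting operators\<close>

text \<open>The purely algebraic setting of the Wick formula, with creation operators \<open>a\<close> and annihilation
  operators \<open>b\<close>; the assumptions \<open>b_vac\<close> and \<open>a_orth\<close> end its two recursions.\<close>

locale q_fock =
  fixes V :: "'h::real_inner set" and \<phi> :: 'h and I :: "nat set"
    and a b :: "nat \<Rightarrow> 'h \<Rightarrow> 'h" and q :: real and c :: "nat \<Rightarrow> nat \<Rightarrow> real"
  assumes V: "subspace V" and vac: "\<phi> \<in> V" "\<phi> \<bullet> \<phi> = 1"
    and a_V: "i \<in> I \<Longrightarrow> v \<in> V \<Longrightarrow> a i v \<in> V"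
    and a_add: "i \<in> I \<Longrightarrow> u \<in> V \<Longrightarrow> v \<in> V \<Longrightarrow> a i (u + v) = a i u + a i v"
    and a_scale: "i \<in> I \<Longrightarrow> v \<in> V \<Longrightarrow> a i (r *\<^sub>R v) = r *\<^sub>R a i v"
    and b_V: "i \<in> I \<Longrightarrow> v \<in> V \<Longrightarrow> b i v \<in> V"
    and b_add: "i \<in> I \<Longrightarrow> u \<in> V \<Longrightarrow> v \<in> V \<Longrightarrow> b i (u + v) = b i u + b i v"
    and b_scale: "i \<in> I \<Longrightarrow> v \<in> V \<Longrightarrow> b i (r *\<^sub>R v) = r *\<^sub>R b i v"
    and b_vac: "i \<in> I \<Longrightarrow> b i \<phi> = 0"
    and a_orth: "i \<in> I \<Longrightarrow> v \<in> V \<Longrightarrow> a i v \<bullet> \<phi> = 0"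
    and comm: "i \<in> I \<Longrightarrow> j \<in> I \<Longrightarrow> v \<in> V \<Longrightarrow> b i (a j v) = q *\<^sub>R a j (b i v) + c i j *\<^sub>R v"
begin

definition word :: "nat list \<Rightarrow> 'h \<Rightarrow> 'h" where
  "word w = foldr (\<lambda>i v. b i v + a i v) w"

text \<open>The vector that belongs to the set \<open>P\<close> of open legs. The order of the creation operators
  matters, since they need not commute.\<close>

definition state :: "('p::linorder \<Rightarrow> nat) \<Rightarrow> 'p set \<Rightarrow> 'h" where
  "state \<sigma> P = foldr (\<lambda>p. a (\<sigma> p)) (sorted_list_of_set P) \<phi>"

lemma a_sum:
  assumes "i \<in> I" "\<And>x. x \<in> A \<Longrightarrow> f x \<in> V"
  shows "a i (\<Sum>x\<in>A. f x) = (\<Sum>x\<in>A. a i (f x))"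
proof -
  have z: "a i 0 = 0" using a_scale[OF assms(1) vac(1), of 0] by simp
  show ?thesis using assms(2)
    by (induction A rule: infinite_finite_induct)
       (simp_all add: z a_add[OF assms(1)] subspace_sum[OF V])
qed

lemma word_V: "set w \<subseteq> I \<Longrightarrow> v \<in> V \<Longrightarrow> word w v \<in> V"
  by (induction w) (auto simp: word_def intro!: subspace_add[OF V] a_V b_V)

lemma word_add: "set w \<subseteq> I \<Longrightarrow> u \<in> V \<Longrightarrow> v \<in> V \<Longrightarrow> word w (u + v) = word w u + word w v"
proof (induction w)
  case (Cons i w)
  then show ?case using word_V[of w u] word_V[of w v] by (simp add: word_def a_add b_add)
qed (simp add: word_def)

lemma word_scale: "set w \<subseteq> I \<Longrightarrow> v \<in> V \<Longrightarrow> word w (r *\<^sub>R v) = r *\<^sub>R word w v"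
proof (induction w)
  case (Cons i w)
  then show ?case using word_V[of w v] by (simp add: word_def a_scale b_scale scaleR_add_right)
qed (simp add: word_def)

lemma word_sum:
  assumes "set w \<subseteq> I" "\<And>x. x \<in> A \<Longrightarrow> f x \<in> V"
  shows "word w (\<Sum>x\<in>A. f x) = (\<Sum>x\<in>A. word w (f x))"
proof -
  have z: "word w 0 = 0" using word_scale[OF assms(1) vac(1), of 0] by simp
  show ?thesis using assms(2)
    by (induction A rule: infinite_finite_induct)
       (simp_all add: z word_add[OF assms(1)] subspace_sum[OF V])
qed

lemma state_empty: "state \<sigma> {} = \<phi>"
  by (simp add: state_def)

lemma state_insert:
  assumes "finite P" "\<And>p. p \<in> P \<Longrightarrow> m < p"
  shows "state \<sigma> (insert m P) = a (\<sigma> m) (state \<sigma> P)"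
proof -
  have "m \<notin> P" using assms(2) by blast
  then have "sorted_list_of_set (insert m P) = insort m (sorted_list_of_set P)"
    using assms(1) by simp
  also have "\<dots> = m # sorted_list_of_set P"
    using assms by (intro insort_is_Cons) (auto intro: less_imp_le)
  finally show ?thesis by (simp add: state_def)
qed

lemma state_V: "finite P \<Longrightarrow> \<sigma> ` P \<subseteq> I \<Longrightarrow> state \<sigma> P \<in> V"
  by (induction P rule: finite_linorder_min_induct) (auto simp: state_empty state_insert vac a_V)

text \<open>Moving \<open>b i\<close> to the right past the creation operator of a leg costs a factor \<open>q\<close>, so reaching
  the leg \<open>p\<close> costs one factor for every leg of \<open>P\<close> before \<open>p\<close>; the term that passes all legs
  dies on the vacuum.\<close>

lemma b_state:
  assumes "finite P" "\<sigma> ` P \<subseteq> I" "i \<in> I"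
  shows "b i (state \<sigma> P) =
    (\<Sum>p\<in>P. (q ^ card {r \<in> P. r < p} * c i (\<sigma> p)) *\<^sub>R state \<sigma> (P - {p}))"
  using assms(1,2)
proof (induction P rule: finite_linorder_min_induct)
  case empty
  then show ?case by (simp add: state_empty b_vac assms(3))
next
  case (insert m P)
  have m: "m \<notin> P" and \<sigma>: "\<sigma> m \<in> I" "\<sigma> ` P \<subseteq> I" using insert by auto
  have sV: "state \<sigma> (P - {p}) \<in> V" for p using insert by (intro state_V) auto
  let ?k = "\<lambda>p. q ^ card {r \<in> P. r < p} * c i (\<sigma> p)"
  have "a (\<sigma> m) (b i (state \<sigma> P)) = (\<Sum>p\<in>P. ?k p *\<^sub>R a (\<sigma> m) (state \<sigma> (P - {p})))"
    using insert \<sigma> sV by (simp add: a_sum a_scale subspace_scale[OF V])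
  also have "\<dots> = (\<Sum>p\<in>P. ?k p *\<^sub>R state \<sigma> (insert m P - {p}))"
  proof (rule sum.cong)
    fix p assume p: "p \<in> P"
    have "insert m P - {p} = insert m (P - {p})" using p m by auto
    moreover have "state \<sigma> (insert m (P - {p})) = a (\<sigma> m) (state \<sigma> (P - {p}))"
      using insert by (intro state_insert) auto
    ultimately show "?k p *\<^sub>R a (\<sigma> m) (state \<sigma> (P - {p})) = ?k p *\<^sub>R state \<sigma> (insert m P - {p})"
      by simp
  qed simp
  finally have 1: "q *\<^sub>R a (\<sigma> m) (b i (state \<sigma> P)) =
      (\<Sum>p\<in>P. (q * ?k p) *\<^sub>R state \<sigma> (insert m P - {p}))"
    by (simp add: scaleR_sum_right)
  have "q * ?k p = q ^ card {r \<in> insert m P. r < p} * c i (\<sigma> p)" if "p \<in> P" for p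
  proof -
    have "{r \<in> insert m P. r < p} = insert m {r \<in> P. r < p}" using insert that by auto
    then show ?thesis using m insert by simp
  qed
  then have 2: "q *\<^sub>R a (\<sigma> m) (b i (state \<sigma> P)) =
      (\<Sum>p\<in>P. (q ^ card {r \<in> insert m P. r < p} * c i (\<sigma> p)) *\<^sub>R state \<sigma> (insert m P - {p}))"
    unfolding 1 by (intro sum.cong) auto
  have 3: "{r. (r = m \<or> r \<in> P) \<and> r < m} = {}" using insert by (auto dest: less_asym)
  have "b i (state \<sigma> (insert m P)) = q *\<^sub>R a (\<sigma> m) (b i (state \<sigma> P)) + c i (\<sigma> m) *\<^sub>R state \<sigma> P"
    using insert \<sigma> assms(3) by (simp add: state_insert comm state_V)
  then show ?case using insert m by (simp add: 2 3)
qed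

text \<open>Splitting the last letter of the word into creation and annihilation part gives the
  recursion of \<open>diagram_sum_step\<close>. The legs \<open>P\<close> must be kept general because both parts change them.\<close>

theorem word_state_moment:
  assumes "finite P" "\<And>p. p \<in> P \<Longrightarrow> m < p" "\<sigma> ` ({1..m} \<union> P) \<subseteq> I"
  shows "word (map \<sigma> [1..<m + 1]) (state \<sigma> P) \<bullet> \<phi> = diagram_sum q c \<sigma> {1..m} P"
  using assms
proof (induction m arbitrary: P)
  case 0
  show ?case
  proof (cases "P = {}")
    case True
    then show ?thesis by (simp add: word_def state_empty vac diagram_sum_empty)
  next
    case False
    \<comment> \<open>The leftmost leg is created last, and a vector just created has no vacuum component.\<close>
    define p where "p = Min P"
    have p: "p \<in> P" using False 0 by (simp add: p_def)
    have "p < r" if r: "r \<in> P - {p}" for r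
    proof -
      have "p \<le> r" using r 0(1) by (auto simp: p_def)
      then show ?thesis using r by auto
    qed
    then have "state \<sigma> P = a (\<sigma> p) (state \<sigma> (P - {p}))"
      using state_insert[of "P - {p}" p \<sigma>] 0 p by (simp add: insert_absorb)
    moreover have "state \<sigma> (P - {p}) \<in> V" using 0 by (intro state_V) auto
    ultimately show ?thesis using False 0 p
      by (simp add: word_def diagram_sum_empty) (auto intro!: a_orth)
  qed
next
  case (Suc m)
  let ?n = "Suc m" and ?w = "map \<sigma> [1..<m + 1]"
  have w: "set ?w \<subseteq> I" and n: "\<sigma> ?n \<in> I" and P: "\<sigma> ` P \<subseteq> I"
    using Suc.prems(3) by (auto simp: image_subset_iff)
  have "word (map \<sigma> [1..<?n + 1]) (state \<sigma> P)
      = word ?w (b (\<sigma> ?n) (state \<sigma> P) + state \<sigma> (insert ?n P))"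
    using Suc.prems by (simp add: word_def state_insert)
  also have "\<dots> = word ?w (b (\<sigma> ?n) (state \<sigma> P)) + word ?w (state \<sigma> (insert ?n P))"
    using Suc.prems n P by (intro word_add w b_V state_V) auto
  also have "word ?w (b (\<sigma> ?n) (state \<sigma> P)) =
      (\<Sum>p\<in>P. (q ^ card {r \<in> P. r < p} * c (\<sigma> ?n) (\<sigma> p)) *\<^sub>R word ?w (state \<sigma> (P - {p})))"
  proof -
    have sV: "state \<sigma> (P - {p}) \<in> V" for p using Suc.prems(1) P by (intro state_V) auto
    show ?thesis using w sV
      by (simp add: b_state[OF Suc.prems(1) P n] word_sum word_scale subspace_scale[OF V]
           del: upt_Suc)
  qed
  finally have "word (map \<sigma> [1..<?n + 1]) (state \<sigma> P) \<bullet> \<phi> =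
      (\<Sum>p\<in>P. q ^ card {r \<in> P. r < p} * c (\<sigma> ?n) (\<sigma> p) * (word ?w (state \<sigma> (P - {p})) \<bullet> \<phi>))
      + word ?w (state \<sigma> (insert ?n P)) \<bullet> \<phi>"
    by (simp add: inner_add_left inner_sum_left del: upt_Suc)
  also have "word ?w (state \<sigma> (insert ?n P)) \<bullet> \<phi> = diagram_sum q c \<sigma> {1..m} (insert ?n P)"
    using Suc.prems by (intro Suc.IH) (auto dest: Suc_lessD)
  also have "(\<Sum>p\<in>P. q ^ card {r \<in> P. r < p} * c (\<sigma> ?n) (\<sigma> p) * (word ?w (state \<sigma> (P - {p})) \<bullet> \<phi>))
      = (\<Sum>p\<in>P. q ^ card {r \<in> P. r < p} * c (\<sigma> ?n) (\<sigma> p) * diagram_sum q c \<sigma> {1..m} (P - {p}))"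
  proof (rule sum.cong)
    fix p assume "p \<in> P"
    have "word ?w (state \<sigma> (P - {p})) \<bullet> \<phi> = diagram_sum q c \<sigma> {1..m} (P - {p})"
      using Suc.prems by (intro Suc.IH) (auto dest: Suc_lessD simp: image_subset_iff)
    then show "q ^ card {r \<in> P. r < p} * c (\<sigma> ?n) (\<sigma> p) * (word ?w (state \<sigma> (P - {p})) \<bullet> \<phi>)
      = q ^ card {r \<in> P. r < p} * c (\<sigma> ?n) (\<sigma> p) * diagram_sum q c \<sigma> {1..m} (P - {p})"
      by simp
  qed simp
  also have "\<dots> + diagram_sum q c \<sigma> {1..m} (insert ?n P) = diagram_sum q c \<sigma> (insert ?n {1..m}) P"
    using Suc.prems by (subst diagram_sum_step) auto
  finally show ?case by (simp add: atLeastAtMostSuc_conv del: upt_Suc)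
qed

end

section \<open>Vanishing of the preservation operators\<close>

context vacuum_space
begin

abbreviation "an i v \<equiv> the (annihilation d X \<phi> i v)"
abbreviation "pr i v \<equiv> the (preservation d X \<phi> i v)"
abbreviation "cr i v \<equiv> the (creation d X \<phi> i v)"

lemma apc_operators_decomposition:
  assumes "i \<in> {1..d}"
  shows "apc_decomposition d X \<phi> i (annihilation d X \<phi> i, preservation d X \<phi> i, creation d X \<phi> i)"
proof -
  have "apc_decomposition d X \<phi> i (apc_operators d X \<phi> i)"
    unfolding apc_operators_def by (rule theI'[OF apc_ex1[OF assms]])
  then show ?thesis by (simp add: annihilation_def preservation_def creation_def)
qed

lemma apc_linear:
  assumes "i \<in> {1..d}"
  shows "linear_operator (annihilation d X \<phi> i)" "dom (annihilation d X \<phi> i) = V"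
    "linear_operator (preservation d X \<phi> i)" "dom (preservation d X \<phi> i) = V"
    "linear_operator (creation d X \<phi> i)" "dom (creation d X \<phi> i) = V"
proof -
  have "\<forall>T\<in>{annihilation d X \<phi> i, preservation d X \<phi> i, creation d X \<phi> i}.
      linear_operator T \<and> dom T = V"
    using apc_operators_decomposition[OF assms] unfolding apc_decomposition_def prod.case
    by (elim conjE)
  then show "linear_operator (annihilation d X \<phi> i)" "dom (annihilation d X \<phi> i) = V"
    "linear_operator (preservation d X \<phi> i)" "dom (preservation d X \<phi> i) = V"
    "linear_operator (creation d X \<phi> i)" "dom (creation d X \<phi> i) = V"
    by simp_all
qed

lemma apc_G:
  assumes "i \<in> {1..d}" "n \<ge> 0" "v \<in> GG n"
  shows "an i v \<in> GG (n - 1)" "pr i v \<in> GG n" "cr i v \<in> GG (n + 1)"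
proof -
  have "an i v \<in> GG (n - 1) \<and> pr i v \<in> GG n \<and> cr i v \<in> GG (n + 1)"
    using apc_operators_decomposition[OF assms(1)] assms(2,3)
    unfolding apc_decomposition_def prod.case by blast
  then show "an i v \<in> GG (n - 1)" "pr i v \<in> GG n" "cr i v \<in> GG (n + 1)" by blast+
qed

lemma apc_sum:
  assumes i: "i \<in> {1..d}" and v: "v \<in> V"
  shows "the (X i v) = an i v + (pr i v + cr i v)"
proof -
  have "X i |` V = op_add (annihilation d X \<phi> i) (op_add (preservation d X \<phi> i) (creation d X \<phi> i))"
    using apc_operators_decomposition[OF i] by (simp add: apc_decomposition_def)
  then have "(X i |` V) v =
      op_add (annihilation d X \<phi> i) (op_add (preservation d X \<phi> i) (creation d X \<phi> i)) v"
    by simp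
  then show ?thesis using v apc_linear[OF i] by (auto simp: op_add_def domIff)
qed

lemma FF_0: "FF 0 = span {\<phi>}"
proof -
  have "{w. set w \<subseteq> {1..d} \<and> length w \<le> 0} = {[]}" by auto
  then show ?thesis by (simp add: FF_def F_space_eq_span[OF prob] op_word_simps)
qed

lemma vac_V: "\<phi> \<in> FF 0" "\<phi> \<in> V" "\<phi> \<in> GG 0"
proof -
  show 1: "\<phi> \<in> FF 0" by (simp add: FF_0 span_base)
  then show "\<phi> \<in> V" using FF_V[of 0] by blast
  have "FF (0 - 1) = {0}" by (simp add: FF_def)
  then show "\<phi> \<in> GG 0" unfolding G_eq using 1 by simp
qed

lemma G_orth:
  assumes "u \<in> GG m" "v \<in> GG n" "m < n"
  shows "v \<bullet> u = 0"
proof -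
  have "u \<in> FF (n - 1)" using G_FF[OF assms(1)] FF_mono[of m "n - 1"] assms(3) by auto
  then show ?thesis using assms(2) by (simp add: G_eq)
qed

text \<open>If all \<open>an i v\<close> vanish, then \<open>X i v\<close> has only components in \<open>GG n\<close> and \<open>GG (n + 1)\<close>. Hence for
  \<open>u\<close> in \<open>FF (n - 1)\<close> the inner product of \<open>v\<close> with \<open>X i u\<close>, which is that of \<open>X i v\<close> with \<open>u\<close>, is zero;
  these vectors and the vacuum span \<open>FF n\<close>, which contains \<open>v\<close>.\<close>

lemma annihilated_zero:
  assumes n: "n > 0" and v: "v \<in> GG n"
    and an: "\<And>i. i \<in> {1..d} \<Longrightarrow> an i v = 0"
  shows "v = 0"
proof -
  have gen: "orthogonal v (the (op_word X w \<phi>))" if w: "set w \<subseteq> {1..d}" "length w \<le> nat n" for w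
  proof (cases w)
    case Nil
    have "\<phi> \<in> FF (n - 1)" using vac_V(1) FF_mono[of 0 "n - 1"] n by auto
    then show ?thesis using v by (simp add: Nil op_word_simps orthogonal_def G_eq)
  next
    case (Cons i w')
    let ?u = "the (op_word X w' \<phi>)"
    have i: "i \<in> {1..d}" using w Cons by auto
    have "?u \<in> F_space d X \<phi> (nat (n - 1))"
      unfolding F_space_eq_span[OF prob] using w Cons by (intro span_base imageI) auto
    then have u: "?u \<in> FF (n - 1)" using n by (simp add: FF_def)
    have "\<phi> \<in> dom (op_word X w)" using w by (intro word_dom)
    then have "the (op_word X w \<phi>) = the (X i ?u)"
      by (auto simp: Cons op_word_simps map_comp_def split: option.splits)
    moreover have "v \<bullet> the (X i ?u) = the (X i v) \<bullet> ?u"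
      using X_props(2)[OF i] X_FF(1)[OF i u] X_FF(1)[OF i G_FF[OF v]]
      by (simp add: symmetric_operator_def)
    moreover have "the (X i v) = pr i v + cr i v"
      using apc_sum[OF i, of v] G_FF[OF v] FF_V[of n] an[OF i] by auto
    moreover have "pr i v \<bullet> ?u = 0" "cr i v \<bullet> ?u = 0"
      using apc_G[OF i _ v] n u FF_mono[of "n - 1" n] by (auto simp: G_eq)
    ultimately show ?thesis by (simp add: orthogonal_def inner_add_left)
  qed
  have "v \<in> span ((\<lambda>w. the (op_word X w \<phi>)) ` {w. set w \<subseteq> {1..d} \<and> length w \<le> nat n})"
    using G_FF[OF v] n by (simp add: FF_def F_space_eq_span[OF prob])
  then have "orthogonal v v"
  proof (rule orthogonal_to_span)
    fix x assume "x \<in> (\<lambda>w. the (op_word X w \<phi>)) ` {w. set w \<subseteq> {1..d} \<and> length w \<le> nat n}"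
    then show "orthogonal v x" using gen by blast
  qed
  then show ?thesis by (simp add: orthogonal_def)
qed

text \<open>The equation of operators includes equality of domains, and so it also shows that \<open>A\<close> and \<open>B\<close>
  map \<open>V\<close> into itself.\<close>

lemma q_commutator_pointwise:
  assumes A: "dom A = V" and B: "dom B = V"
    and comm: "q_commutator q A B = op_scale r op_id |` V" and v: "v \<in> V"
  shows "the (B v) \<in> V" "the (A v) \<in> V" "the (A (the (B v))) = q *\<^sub>R the (B (the (A v))) + r *\<^sub>R v"
proof -
  obtain x y where xy: "A v = Some x" "B v = Some y" using A B v by blast
  have eq: "q_commutator q A B v = Some (r *\<^sub>R v)" using v by (simp add: comm op_scale_def)
  then have "v \<in> dom (A \<circ>\<^sub>m B)" "v \<in> dom (op_scale (- q) (B \<circ>\<^sub>m A))"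
    by (auto simp: q_commutator_def op_add_def split: if_splits)
  then obtain x' y' where xy': "A y = Some y'" "B x = Some x'" 
    using xy by (auto simp: op_scale_def)
  then show "the (B v) \<in> V" "the (A v) \<in> V" using A B xy by (auto simp: dom_def)
  have "y' + (- q) *\<^sub>R x' = r *\<^sub>R v"
    using eq xy xy' by (simp add: q_commutator_def op_add_def op_scale_def dom_def)
  then show "the (A (the (B v))) = q *\<^sub>R the (B (the (A v))) + r *\<^sub>R v"
    using xy xy' by (simp add: algebra_simps)
qed

text \<open>Induction on the grade: on \<open>GG (n + 1)\<close> the commutation relation and the induction hypothesis
  for \<open>an i v\<close> show that \<open>pr j v\<close> is killed by every annihilation operator. On \<open>GG 0\<close>, the line of the
  vacuum, \<open>pr j\<close> is multiplication by the mean of \<open>X j\<close>.\<close>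

lemma preservation_zero:
  assumes comm: "\<And>i j. i \<in> {1..d} \<Longrightarrow> j \<in> {1..d} \<Longrightarrow>
        q_commutator q (annihilation d X \<phi> i) (preservation d X \<phi> j) = op_scale 0 op_id |` V"
    and mean: "\<And>i. i \<in> {1..d} \<Longrightarrow> expectation \<phi> (X i) = 0"
    and j: "j \<in> {1..d}" and v: "v \<in> V"
  shows "pr j v = 0"
proof -
  have G: "pr j v = 0" if "v \<in> GG (int n)" for n v
    using that
  proof (induction n arbitrary: v)
    case 0
    have "an j \<phi> = 0" using apc_G(1)[OF j _ vac_V(3)] by (simp add: G_space_def)
    moreover have "cr j \<phi> \<bullet> \<phi> = 0" using G_orth[OF vac_V(3) apc_G(3)[OF j _ vac_V(3)]] by simp
    ultimately have "pr j \<phi> \<bullet> \<phi> = 0"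
      using mean[OF j] apc_sum[OF j vac_V(2)] by (simp add: expectation_def inner_add_left)
    moreover obtain s where "pr j \<phi> = s *\<^sub>R \<phi>"
      using G_FF[OF apc_G(2)[OF j _ vac_V(3)]] by (auto simp: FF_0 span_singleton)
    ultimately have "pr j \<phi> = 0" by auto
    moreover obtain r where "v = r *\<^sub>R \<phi>"
      using G_FF[OF 0] by (auto simp: FF_0 span_singleton)
    ultimately show ?case
      using apc_linear(3,4)[OF j] vac_V(2) by (simp add: linear_operator_def)
  next
    case (Suc n)
    have vV: "v \<in> V" using G_FF[OF Suc.prems] FF_V by blast
    show ?case
    proof (rule annihilated_zero)
      show "pr j v \<in> GG (int (Suc n))" using apc_G(2)[OF j _ Suc.prems] by simp
      fix i assume i: "i \<in> {1..d}"
      have "an i v \<in> GG (int n)" using apc_G(1)[OF i _ Suc.prems] by simp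
      then have "pr j (an i v) = 0" by (rule Suc.IH)
      then show "an i (pr j v) = 0"
        using q_commutator_pointwise(3)[OF apc_linear(2)[OF i] apc_linear(4)[OF j] comm[OF i j] vV]
        by simp
    qed simp
  qed
  have T: "linear_operator ((\<lambda>x. Some 0) |` V)" "dom ((\<lambda>x. Some 0) |` V) = V"
    using subspace_V by (auto simp: linear_operator_def subspace_add subspace_scale)
  have "preservation d X \<phi> j = (\<lambda>x. Some 0) |` V"
  proof (rule linear_operator_ext[OF apc_linear(3,4)[OF j] T])
    fix n v assume n: "n \<ge> 0" and v: "v \<in> GG n"
    then have "v \<in> V" using G_FF FF_V by blast
    then show "pr j v = the (((\<lambda>x. Some 0) |` V) v)" using G[of v "nat n"] n v by simp
  qed
  then show ?thesis using v by simp
qed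

lemma cr_orth:
  assumes i: "i \<in> {1..d}" and v: "v \<in> V"
  shows "cr i v \<bullet> \<phi> = 0"
proof -
  define S where "S = {v \<in> V. cr i v \<bullet> \<phi> = 0}"
  have S: "subspace S"
  proof (rule subspaceI)
    show "0 \<in> S"
      using linear_operator_zero(2)[OF apc_linear(5)[OF i]] subspace_0[OF subspace_V]
      by (simp add: S_def)
  next
    fix x y assume "x \<in> S" "y \<in> S"
    moreover from this have "cr i (x + y) = cr i x + cr i y"
      using apc_linear(5,6)[OF i] by (simp add: S_def linear_operator_def)
    ultimately show "x + y \<in> S"
      by (simp add: S_def subspace_add[OF subspace_V] inner_add_left)
  next
    fix x r assume "x \<in> S"
    moreover from this have "cr i (r *\<^sub>R x) = r *\<^sub>R cr i x"
      using apc_linear(5,6)[OF i] by (simp add: S_def linear_operator_def)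
    ultimately show "r *\<^sub>R x \<in> S" by (simp add: S_def subspace_scale[OF subspace_V])
  qed
  obtain N where N: "v \<in> FF (int N)" using V_bound[OF v] by blast
  have "E (int n) v \<in> S" for n
    using G_orth[OF vac_V(3) apc_G(3)[OF i _ E_G, of "int n" v]] E_V by (simp add: S_def)
  then have "(\<Sum>n\<le>N. E (int n) v) \<in> S" by (intro subspace_sum[OF S])
  then have "v \<in> S" by (simp only: sum_E[OF N, symmetric])
  then show ?thesis by (simp add: S_def)
qed

lemma q_fock_vacuum:
  assumes ac: "\<And>i j. i \<in> {1..d} \<Longrightarrow> j \<in> {1..d} \<Longrightarrow>
        q_commutator q (annihilation d X \<phi> i) (creation d X \<phi> j) = op_scale (c i j) op_id |` V"
  shows "q_fock V \<phi> {1..d} cr an q c"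
proof
  show "subspace V" "\<phi> \<in> V" by (rule subspace_V, rule vac_V(2))
  show "\<phi> \<bullet> \<phi> = 1" using prob by (simp add: noncomm_prob_space_def norm_eq_1)
  fix i assume i: "i \<in> {1..d}"
  show "an i \<phi> = 0" using apc_G(1)[OF i _ vac_V(3)] by (simp add: G_space_def)
  note lin = apc_linear[OF i]
  fix v r assume v: "v \<in> V"
  show "cr i v \<in> V" "an i v \<in> V"
    using q_commutator_pointwise(1,2)[OF lin(2) lin(6) ac[OF i i] v] .
  show "cr i (r *\<^sub>R v) = r *\<^sub>R cr i v" "an i (r *\<^sub>R v) = r *\<^sub>R an i v"
    using lin v by (simp_all add: linear_operator_def)
  show "cr i v \<bullet> \<phi> = 0" using cr_orth[OF i v] .
  show "cr i (v + u) = cr i v + cr i u" "an i (v + u) = an i v + an i u" if "u \<in> V" for u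
    using lin v that by (simp_all add: linear_operator_def)
  show "an i (cr j v) = q *\<^sub>R cr j (an i v) + c i j *\<^sub>R v" if j: "j \<in> {1..d}" for j
    using q_commutator_pointwise(3)[OF lin(2) apc_linear(6)[OF j] ac[OF i j] v] .
qed

lemma op_word_vac:
  assumes "\<And>i v. i \<in> {1..d} \<Longrightarrow> v \<in> V \<Longrightarrow> the (X i v) = f i v" and "set w \<subseteq> {1..d}"
  shows "the (op_word X w \<phi>) \<in> V \<and> the (op_word X w \<phi>) = foldr f w \<phi>"
  using assms(2)
proof (induction w)
  case Nil
  then show ?case by (simp add: op_word_simps vac_V)
next
  case (Cons i w)
  have "\<phi> \<in> dom (op_word X (i # w))" by (rule word_dom[OF Cons.prems])
  then have "the (op_word X (i # w) \<phi>) = the (X i (the (op_word X w \<phi>)))"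
    by (auto simp: op_word_simps map_comp_def split: option.splits)
  moreover have "the (op_word X (i # w) \<phi>) \<in> V"
    using op_word_in_algebra[OF Cons.prems] by (auto simp: vacuum_domain_def)
  moreover have IH: "the (op_word X w \<phi>) \<in> V \<and> the (op_word X w \<phi>) = foldr f w \<phi>"
    by (rule Cons.IH) (use Cons.prems in simp)
  moreover have "the (X i (the (op_word X w \<phi>))) = f i (the (op_word X w \<phi>))"
    by (rule assms(1)[OF _ IH[THEN conjunct1]]) (use Cons.prems in simp)
  ultimately show ?case by simp
qed

end

theorem mainTheorem3:
  fixes q :: real and d :: nat and c :: "nat \<Rightarrow> nat \<Rightarrow> real"
    and X :: "nat \<Rightarrow> ('h::{real_inner, complete_space}) operator" and \<phi> :: 'h
    and k :: nat and \<sigma> :: "nat \<Rightarrow> nat"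
  assumes "q \<in> {-1..1}"
    and "d \<ge> 1"
    and "positive_definite d c"
    and "noncomm_prob_space d X \<phi>"
    and "\<And>i j. i \<in> {1..d} \<Longrightarrow> j \<in> {1..d} \<Longrightarrow>
           q_commutator q (annihilation d X \<phi> i) (creation d X \<phi> j)
             = op_scale (c i j) op_id |` vacuum_domain d X \<phi>"
    and "\<And>i j. i \<in> {1..d} \<Longrightarrow> j \<in> {1..d} \<Longrightarrow>
           q_commutator q (annihilation d X \<phi> i) (preservation d X \<phi> j)
             = op_scale 0 op_id |` vacuum_domain d X \<phi>"
    and "\<And>i. i \<in> {1..d} \<Longrightarrow> expectation \<phi> (X i) = 0"
    and "\<And>r. r \<in> {1..k} \<Longrightarrow> \<sigma> r \<in> {1..d}"
  shows "(odd k \<longrightarrow> expectation \<phi> (op_word X (map \<sigma> [1..<k + 1])) = 0) \<and>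
    (\<forall>n. k = 2 * n \<longrightarrow> expectation \<phi> (op_word X (map \<sigma> [1..<k + 1])) =
       (\<Sum>\<gamma>\<in>complete_feynman {1..2 * n}. q ^ crossing_number \<gamma> * diagram_weight c \<sigma> \<gamma>))"
proof -
  interpret vacuum_space d X \<phi> by unfold_locales (rule assms(4))
  interpret q_fock V \<phi> "{1..d}" cr an q c
    by (rule q_fock_vacuum[OF assms(5)])
  have X: "the (X i v) = an i v + cr i v" if "i \<in> {1..d}" "v \<in> V" for i v
    using apc_sum[OF that] preservation_zero[OF assms(6,7) that] by simp
  have "set (map \<sigma> [1..<k + 1]) \<subseteq> {1..d}" using assms(8) by fastforce
  from op_word_vac[OF X this]
  have "expectation \<phi> (op_word X (map \<sigma> [1..<k + 1])) =
      word (map \<sigma> [1..<k + 1]) (state \<sigma> {}) \<bullet> \<phi>"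
    by (simp add: expectation_def word_def state_empty del: upt_Suc)
  also have "\<dots> = diagram_sum q c \<sigma> {1..k} {}"
    by (rule word_state_moment) (use assms(8) in \<open>auto simp: image_subset_iff\<close>)
  also have "\<dots> =
      (\<Sum>\<gamma>\<in>complete_feynman {1..k}. q ^ crossing_number \<gamma> * diagram_weight c \<sigma> \<gamma>)"
    by (simp add: diagram_sum_def open_diagrams_closed)
  finally have moment: "expectation \<phi> (op_word X (map \<sigma> [1..<k + 1])) =
      (\<Sum>\<gamma>\<in>complete_feynman {1..k}. q ^ crossing_number \<gamma> * diagram_weight c \<sigma> \<gamma>)" .
  show ?thesis
  proof (intro conjI impI allI)
    assume "odd k"
    then have "complete_feynman {1..k} = {}" by (intro complete_feynman_odd) simp_all
    then show "expectation \<phi> (op_word X (map \<sigma> [1..<k + 1])) = 0"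
      by (simp only: moment sum.empty)
  next
    fix n assume "k = 2 * n"
    with moment show "expectation \<phi> (op_word X (map \<sigma> [1..<k + 1])) =
        (\<Sum>\<gamma>\<in>complete_feynman {1..2 * n}. q ^ crossing_number \<gamma> * diagram_weight c \<sigma> \<gamma>)"
      by (simp only:)
  qed
qed

end
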